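(* Let $n\ge 2$ and let $\Sigma^n$ be a homothetic soliton hypersurface for the inverse mean curvature flow in $\mathbb{R}^{n+1}$. If $\Sigma$ is closed, then it is a round hypersphere (centered at the origin).
   Context: For a submanifold $\Sigma^n\subset\mathbb{R}^N$ with position vector $X$ and induced metric $g$, the mean curvature vector is $\overrightarrow{H}=\triangle_g X$. A submanifold $\Sigma^n\subset\mathbb{R}^N$ with nonvanishing mean curvature vector field $\overrightarrow{H}$ is called a homothetic soliton for the inverse mean curvature flow if there is a constant $C\in\mathbb{R}\setminus\{0\}$ such that \[ -\frac{1}{|\overrightarrow{H}|^2}\overrightarrow{H}=C\,X^{\perp}\quad\text{on }\Sigma, \] where $X^\perp$ is the normal component of $X$. A hypersurface is a submanifold of codimension one ($N=n+1$). Closed means compact without boundary.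
   Formalization: The hypersurface is additionally assumed connected and nonempty; otherwise the claim fails, e.g. for the union of two concentric spheres centered at the origin, which satisfies the soliton equation with the same constant C = 1/n. *)

theory Defs
  imports "HOL-Analysis.Analysis"
begin

definition partial_deriv :: "'n::finite \<Rightarrow> (real^'n \<Rightarrow> 'b::real_normed_vector) \<Rightarrow> real^'n \<Rightarrow> 'b" where
  "partial_deriv i f u = frechet_derivative f (at u) (axis i 1)"

primrec Ck_on :: "nat \<Rightarrow> (real^'n::finite) set \<Rightarrow> (real^'n \<Rightarrow> 'b::real_normed_vector) \<Rightarrow> bool" where
  "Ck_on 0 U f \<longleftrightarrow> continuous_on U f"
| "Ck_on (Suc k) U f \<longleftrightarrow>
     (\<forall>u\<in>U. f differentiable (at u)) \<and> (\<forall>i. Ck_on k U (partial_deriv i f))"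

text \<open>Only meant for open \<open>U\<close>, where the derivatives do not depend on values outside \<open>U\<close>.\<close>
definition smooth_on :: "(real^'n::finite) set \<Rightarrow> (real^'n \<Rightarrow> 'b::real_normed_vector) \<Rightarrow> bool" where
  "smooth_on U f \<longleftrightarrow> (\<forall>k. Ck_on k U f)"

definition local_parametrization ::
    "(real^'m::finite) set \<Rightarrow> (real^'n::finite) set \<Rightarrow> (real^'n \<Rightarrow> real^'m) \<Rightarrow> bool" where
  "local_parametrization \<Sigma> U \<phi> \<longleftrightarrow>
     open U \<and> smooth_on U \<phi> \<and>
     (\<forall>u\<in>U. inj (frechet_derivative \<phi> (at u))) \<and>
     (\<exists>\<psi>. homeomorphism U (\<phi> ` U) \<phi> \<psi>) \<and>
     openin (top_of_set \<Sigma>) (\<phi> ` U)"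

text \<open>Smooth (embedded) submanifolds without boundary; their dimension is \<open>CARD('n)\<close>.
  Connectedness is not part of the definition.\<close>
definition submanifold :: "'n::finite itself \<Rightarrow> (real^'m::finite) set \<Rightarrow> bool" where
  "submanifold (_ :: 'n itself) \<Sigma> \<longleftrightarrow>
     (\<forall>p\<in>\<Sigma>. \<exists>U (\<phi> :: real^'n \<Rightarrow> real^'m). local_parametrization \<Sigma> U \<phi> \<and> p \<in> \<phi> ` U)"

definition induced_metric :: "(real^'n::finite \<Rightarrow> real^'m::finite) \<Rightarrow> real^'n \<Rightarrow> real^'n^'n" where
  "induced_metric \<phi> u = (\<chi> i j. partial_deriv i \<phi> u \<bullet> partial_deriv j \<phi> u)"

definition laplace_beltrami ::
    "(real^'n::finite \<Rightarrow> real^'n^'n) \<Rightarrow> (real^'n \<Rightarrow> 'b::real_normed_vector) \<Rightarrow> real^'n \<Rightarrow> 'b" where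
  "laplace_beltrami g f u =
     (1 / sqrt (det (g u))) *\<^sub>R
       (\<Sum>i\<in>UNIV. partial_deriv i
          (\<lambda>v. \<Sum>j\<in>UNIV. (sqrt (det (g v)) * matrix_inv (g v) $ i $ j) *\<^sub>R partial_deriv j f v) u)"

text \<open>In a local parametrization \<open>\<phi>\<close> the position vector is \<open>\<phi>\<close> itself, so the mean curvature
  vector, i.e. the Laplacian of the position vector with respect to the induced metric, is
  \<open>laplace_beltrami (induced_metric \<phi>) \<phi>\<close>. The Laplacian is invariant under changes
  of coordinates, so these local expressions patch together to one vector field on \<open>\<Sigma>\<close>.
  The values of \<open>H\<close> outside \<open>\<Sigma>\<close> are irrelevant.\<close>
definition mean_curvature_field ::
    "'n::finite itself \<Rightarrow> (real^'m::finite) set \<Rightarrow> (real^'m \<Rightarrow> real^'m) \<Rightarrow> bool" where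
  "mean_curvature_field (_ :: 'n itself) \<Sigma> H \<longleftrightarrow>
     (\<forall>U (\<phi> :: real^'n \<Rightarrow> real^'m). local_parametrization \<Sigma> U \<phi> \<longrightarrow>
        (\<forall>u\<in>U. H (\<phi> u) = laplace_beltrami (induced_metric \<phi>) \<phi> u))"

definition tangent_space :: "(real^'m::finite) set \<Rightarrow> real^'m \<Rightarrow> (real^'m) set" where
  "tangent_space \<Sigma> p =
     {v. \<exists>\<gamma>. range \<gamma> \<subseteq> \<Sigma> \<and> \<gamma> 0 = p \<and> (\<gamma> has_vector_derivative v) (at (0::real))}"

text \<open>The normal component of the position vector at \<open>p\<close>.\<close>
definition normal_position :: "(real^'m::finite) set \<Rightarrow> real^'m \<Rightarrow> real^'m" where
  "normal_position \<Sigma> p =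
     (THE w. w \<in> (tangent_space \<Sigma> p)\<^sup>\<bottom> \<and> p - w \<in> tangent_space \<Sigma> p)"

definition homothetic_soliton :: "'n::finite itself \<Rightarrow> (real^'m::finite) set \<Rightarrow> bool" where
  "homothetic_soliton (T :: 'n itself) \<Sigma> \<longleftrightarrow>
     submanifold T \<Sigma> \<and>
     (\<exists>H. mean_curvature_field T \<Sigma> H \<and>
          (\<forall>p\<in>\<Sigma>. H p \<noteq> 0) \<and>
          (\<exists>C. C \<noteq> 0 \<and>
             (\<forall>p\<in>\<Sigma>. - ((1 / (norm (H p))\<^sup>2) *\<^sub>R H p) = C *\<^sub>R normal_position \<Sigma> p)))"

end

theory Submission
  imports Defs
begin

text \<open>Let \<open>w\<close> be the normal component of \<open>X\<close>. Since \<open>X - w\<close> is tangent, \<open>w \<bullet> X = \<bar>w\<bar>\<^sup>2\<close>, and the soliton equation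
  gives \<open>H \<bullet> X = - 1 / C\<close>. Hence the Laplacian of \<open>\<bar>X\<bar>\<^sup>2\<close> is \<open>2 n + 2 H \<bullet> X = 2 n - 2 / C\<close>, a constant.
  At a maximum and at a minimum of \<open>\<bar>X\<bar>\<^sup>2\<close> this constant is nonpositive and nonnegative, respectively, so
  \<open>\<bar>X\<bar>\<^sup>2\<close> is harmonic, and it is constant by the strong maximum principle of Hopf. Thus \<open>\<Sigma>\<close> is a
  compact subset of a sphere, and it is open in this sphere by invariance of domain.\<close>

section \<open>Partial derivatives and second order operators\<close>

text \<open>The maximum principle lives in charts. There the divergence form of the Laplacian is
  expanded into \<open>second_order_op a b\<close>, with \<open>a\<close> the inverse metric and
  \<open>b\<close> a drift. Both are continuous, and the same pair serves for \<open>\<phi>\<close>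
  and for \<open>\<phi> \<bullet> \<phi>\<close>. Positive definiteness is carried as a pointwise
  factorization \<open>a u = V ** transpose V\<close> with \<open>V\<close> invertible: the columns
  of \<open>V\<close> are directions for the second derivative test, and the squared norm of
  \<open>transpose V *v x\<close> is the quadratic form in Hopf's barrier. Two definitions have to
  be unlocked. \<open>tangent_space\<close> consists of velocities of curves, and
  \<open>normal_position\<close> is a definite description, meaningful once the tangent space is
  known to be a linear subspace; identifying it with the range of the derivative of a chart provides
  this. No sign of \<open>C\<close> is presupposed: comparing maximum and minimum forces C =
  1/n.\<close>

lemma partial_deriv_eq:
  "(f has_derivative f') (at u) \<Longrightarrow> partial_deriv i f u = f' (axis i 1)"
  unfolding partial_deriv_def using frechet_derivative_at by metis

lemma has_derivative_partial_deriv: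
  fixes f :: "real^'n::finite \<Rightarrow> 'b::real_normed_vector"
  assumes "f differentiable (at u)"
  shows "(f has_derivative (\<lambda>v. \<Sum>j\<in>UNIV. v $ j *\<^sub>R partial_deriv j f u)) (at u)"
proof -
  obtain f' where f': "(f has_derivative f') (at u)"
    using assms by (auto simp: differentiable_def)
  interpret f': bounded_linear f' using f' by (rule has_derivative_bounded_linear)
  have "f' v = (\<Sum>j\<in>UNIV. v $ j *\<^sub>R partial_deriv j f u)" for v
  proof -
    have "f' v = f' (\<Sum>j\<in>UNIV. v $ j *\<^sub>R axis j 1)"
      by (simp add: basis_expansion flip: scalar_mult_eq_scaleR)
    also have "\<dots> = (\<Sum>j\<in>UNIV. v $ j *\<^sub>R f' (axis j 1))"
      by (simp add: f'.sum f'.scaleR)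
    finally show ?thesis by (simp add: partial_deriv_eq[OF f'])
  qed
  then show ?thesis using f' by presburger
qed

text \<open>Formulas for first partial derivatives are available only on an open set; locality
  allows them to be differentiated once more.\<close>

lemma partial_deriv_cong:
  assumes "open U" "u \<in> U" "\<And>v. v \<in> U \<Longrightarrow> f v = g v"
  shows "partial_deriv i f u = partial_deriv i g u"
proof -
  have "(f has_derivative D) (at u) \<longleftrightarrow> (g has_derivative D) (at u)" for D
    using has_derivative_transform_within_open[OF _ assms(1,2), of f D UNIV g]
      has_derivative_transform_within_open[OF _ assms(1,2), of g D UNIV f] assms(3) by auto
  then show ?thesis by (simp add: partial_deriv_def frechet_derivative_def)
qed

lemma differentiable_cong_open:
  assumes "open U" "u \<in> U" "\<And>v. v \<in> U \<Longrightarrow> f v = g v"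
  shows "f differentiable (at u) \<longleftrightarrow> g differentiable (at u)"
  using has_derivative_transform_within_open[OF _ assms(1,2), of f _ UNIV g]
    has_derivative_transform_within_open[OF _ assms(1,2), of g _ UNIV f] assms(3)
  by (auto simp: differentiable_def)

lemma has_derivative_frechet:
  "f differentiable (at u) \<Longrightarrow> (f has_derivative frechet_derivative f (at u)) (at u)"
  using frechet_derivative_works by blast

lemma partial_deriv_add:
  assumes "f differentiable (at u)" "g differentiable (at u)"
  shows "partial_deriv i (\<lambda>v. f v + g v) u = partial_deriv i f u + partial_deriv i g u"
  using partial_deriv_eq[OF has_derivative_add[OF assms[THEN has_derivative_frechet]]]
  by (simp add: partial_deriv_def)

lemma partial_deriv_sum:
  assumes "\<And>j. j \<in> J \<Longrightarrow> f j differentiable (at u)"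
  shows "partial_deriv i (\<lambda>v. \<Sum>j\<in>J. f j v) u = (\<Sum>j\<in>J. partial_deriv i (f j) u)"
  using partial_deriv_eq[OF has_derivative_sum[of J f "\<lambda>j. frechet_derivative (f j) (at u)"]]
    assms[THEN has_derivative_frechet]
  by (simp add: partial_deriv_def)

lemma partial_deriv_scaleR:
  assumes "f differentiable (at u)" "g differentiable (at u)"
  shows "partial_deriv i (\<lambda>v. f v *\<^sub>R g v) u = f u *\<^sub>R partial_deriv i g u + partial_deriv i f u *\<^sub>R g u"
  using partial_deriv_eq[OF has_derivative_scaleR[OF assms[THEN has_derivative_frechet]]]
  by (simp add: partial_deriv_def)

lemma partial_deriv_inner:
  assumes "f differentiable (at u)" "g differentiable (at u)"
  shows "partial_deriv i (\<lambda>v. f v \<bullet> g v) u = f u \<bullet> partial_deriv i g u + partial_deriv i f u \<bullet> g u"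
  using partial_deriv_eq[OF has_derivative_inner[OF assms[THEN has_derivative_frechet]]]
  by (simp add: partial_deriv_def)

section \<open>Second order operators and the second derivative test\<close>

definition twice_differentiable_on ::
    "(real^'n::finite) set \<Rightarrow> (real^'n \<Rightarrow> 'b::real_normed_vector) \<Rightarrow> bool" where
  "twice_differentiable_on U h \<longleftrightarrow>
     (\<forall>u\<in>U. h differentiable (at u) \<and> (\<forall>j. partial_deriv j h differentiable (at u)))"

text \<open>A linear operator in non-divergence form. The codomain is a general normed space, so
  that the same operator acts on a chart and on its squared norm.\<close>

definition second_order_op ::
    "(real^'n::finite \<Rightarrow> real^'n^'n) \<Rightarrow> (real^'n \<Rightarrow> real^'n) \<Rightarrow> (real^'n \<Rightarrow> 'b::real_normed_vector) \<Rightarrow>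
      real^'n \<Rightarrow> 'b" where
  "second_order_op a b h u =
     (\<Sum>i\<in>UNIV. \<Sum>j\<in>UNIV. a u $ i $ j *\<^sub>R partial_deriv i (partial_deriv j h) u) +
     (\<Sum>j\<in>UNIV. b u $ j *\<^sub>R partial_deriv j h u)"

lemma has_real_derivative_along_line:
  fixes f :: "real^'n::finite \<Rightarrow> real"
  assumes "f differentiable (at (u + t *\<^sub>R v))"
  shows "((\<lambda>t. f (u + t *\<^sub>R v)) has_real_derivative
    (\<Sum>j\<in>UNIV. v $ j * partial_deriv j f (u + t *\<^sub>R v))) (at t)"
proof -
  have "((\<lambda>t. u + t *\<^sub>R v) has_derivative (\<lambda>s. s *\<^sub>R v)) (at t)"
    by (auto intro!: derivative_eq_intros)
  from has_derivative_compose[OF this has_derivative_partial_deriv[OF assms]]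
  show ?thesis
    unfolding has_field_derivative_def
    by (rule has_derivative_eq_rhs) (simp add: fun_eq_iff sum_distrib_left sum_distrib_right mult_ac)
qed

text \<open>Restriction to the line through \<open>u\<close> in direction \<open>v\<close> reduces
  the second claim to one variable. The second derivative along the line enters only at 0, so a sign
  argument for \<open>k'\<close> takes the place of a Taylor expansion.\<close>

lemma second_derivative_test:
  fixes h :: "real^'n::finite \<Rightarrow> real"
  assumes U: "open U" "u \<in> U" and h: "twice_differentiable_on U h"
    and max: "\<And>x. x \<in> U \<Longrightarrow> h x \<le> h u"
  shows "partial_deriv j h u = 0"
    and "(\<Sum>i\<in>UNIV. \<Sum>j\<in>UNIV. v $ i * v $ j * partial_deriv i (partial_deriv j h) u) \<le> 0"
proof -
  have d: "h differentiable (at x)" "partial_deriv j h differentiable (at x)" if "x \<in> U" for x j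
    using h that by (auto simp: twice_differentiable_on_def)
  show grad: "partial_deriv j h u = 0" for j
  proof -
    have "frechet_derivative h (at u) = (\<lambda>v. 0)"
      by (rule has_derivative_local_max[OF has_derivative_frechet[OF d(1)[OF U(2)]]])
         (use eventually_at_topological U max in blast)
    then show ?thesis by (simp add: partial_deriv_def)
  qed
  obtain e where e: "e > 0" "\<And>t. \<bar>t\<bar> < e \<Longrightarrow> u + t *\<^sub>R v \<in> U"
  proof -
    have "open ((\<lambda>t. u + t *\<^sub>R v) -` U)"
      by (intro open_vimage U continuous_intros)
    moreover have "0 \<in> (\<lambda>t. u + t *\<^sub>R v) -` U" using U by simp
    ultimately obtain e where "e > 0" "ball 0 e \<subseteq> (\<lambda>t. u + t *\<^sub>R v) -` U"
      by (meson openE)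
    then show ?thesis using that[of e] by (auto simp: subset_iff)
  qed
  define k where "k t = h (u + t *\<^sub>R v)" for t
  define k' where "k' t = (\<Sum>j\<in>UNIV. v $ j * partial_deriv j h (u + t *\<^sub>R v))" for t
  have k: "(k has_real_derivative k' t) (at t)" if "\<bar>t\<bar> < e" for t
    unfolding k_def[abs_def] k'_def by (rule has_real_derivative_along_line[OF d(1)[OF e(2)[OF that]]])
  have k': "(k' has_real_derivative (\<Sum>j\<in>UNIV. v $ j * (\<Sum>i\<in>UNIV. v $ i * partial_deriv i (partial_deriv j h) u))) (at 0)"
  proof -
    have "((\<lambda>t. partial_deriv j h (u + t *\<^sub>R v)) has_real_derivative
        (\<Sum>i\<in>UNIV. v $ i * partial_deriv i (partial_deriv j h) u)) (at 0)" for j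
      using has_real_derivative_along_line[of "partial_deriv j h" u 0 v] d(2)[OF U(2)] by simp
    then show ?thesis unfolding k'_def[abs_def] by (intro DERIV_sum DERIV_cmult)
  qed
  have k0: "k' 0 = 0" by (simp add: k'_def grad)
  \<comment> \<open>A positive derivative of \<open>k'\<close> at 0, where \<open>k'\<close>
    vanishes, makes \<open>k'\<close> positive just to the right; by the mean value theorem
    \<open>k\<close> then rises above its maximum.\<close>
  have "\<not> (\<Sum>j\<in>UNIV. v $ j * (\<Sum>i\<in>UNIV. v $ i * partial_deriv i (partial_deriv j h) u)) > 0"
  proof
    assume "(\<Sum>j\<in>UNIV. v $ j * (\<Sum>i\<in>UNIV. v $ i * partial_deriv i (partial_deriv j h) u)) > 0"
    from DERIV_pos_inc_right[OF k' this] obtain d where d: "d > 0" "\<And>t. 0 < t \<Longrightarrow> t < d \<Longrightarrow> 0 < k' t"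
      using k0 by auto
    define t where "t = min d e / 2"
    have t: "0 < t" "t < d" "t < e" using d(1) e(1) by (auto simp: t_def)
    obtain z where z: "0 < z" "z < t" "k t - k 0 = (t - 0) * k' z"
      using MVT2[of 0 t k k'] k t by (auto simp: abs_real_def)
    have "k t > k 0" using z t d(2)[of z] by (simp add: field_simps)
    moreover have "k t \<le> k 0" using max[of "u + t *\<^sub>R v"] e(2)[of t] t by (simp add: k_def)
    ultimately show False by simp
  qed
  then show "(\<Sum>i\<in>UNIV. \<Sum>j\<in>UNIV. v $ i * v $ j * partial_deriv i (partial_deriv j h) u) \<le> 0"
    by (subst sum.swap) (simp add: sum_distrib_left mult_ac not_less)
qed

text \<open>At the maximum the gradient vanishes and with it the drift term. The factorization of
  \<open>a u\<close> splits the rest into second derivatives along the columns of \<open>V\<close>,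
  each of them nonpositive.\<close>

lemma second_order_op_nonpos_at_max:
  fixes h :: "real^'n::finite \<Rightarrow> real"
  assumes U: "open U" "u \<in> U" and h: "twice_differentiable_on U h"
    and max: "\<And>x. x \<in> U \<Longrightarrow> h x \<le> h u"
    and a: "a u = V ** transpose V"
  shows "second_order_op a b h u \<le> 0"
proof -
  note t = second_derivative_test[OF U h max]
  have "second_order_op a b h u =
     (\<Sum>i\<in>UNIV. \<Sum>j\<in>UNIV. \<Sum>k\<in>UNIV. V $ i $ k * V $ j $ k * partial_deriv i (partial_deriv j h) u)"
    by (simp add: second_order_op_def t(1) a matrix_matrix_mult_def transpose_def sum_distrib_right)
  also have "\<dots> = (\<Sum>k\<in>UNIV. \<Sum>i\<in>UNIV. \<Sum>j\<in>UNIV. V $ i $ k * V $ j $ k * partial_deriv i (partial_deriv j h) u)"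
    by (subst sum.swap[of _ UNIV "UNIV :: 'n set"], subst (2) sum.swap) (rule refl)
  also have "\<dots> \<le> 0"
  proof (rule sum_nonpos)
    fix k
    show "(\<Sum>i\<in>UNIV. \<Sum>j\<in>UNIV. V $ i $ k * V $ j $ k * partial_deriv i (partial_deriv j h) u) \<le> 0"
      using t(2)[of "\<chi> i. V $ i $ k"] by simp
  qed
  finally show ?thesis .
qed

lemma twice_differentiable_on_add:
  assumes U: "open U" and f: "twice_differentiable_on U f" and g: "twice_differentiable_on U g"
  shows "twice_differentiable_on U (\<lambda>v. f v + g v)"
    and "u \<in> U \<Longrightarrow> second_order_op a b (\<lambda>v. f v + g v) u = second_order_op a b f u + second_order_op a b g u"
proof -
  have *: "partial_deriv j (\<lambda>v. f v + g v) v = partial_deriv j f v + partial_deriv j g v" if "v \<in> U" for v j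
    using f g that by (intro partial_deriv_add) (auto simp: twice_differentiable_on_def)
  have **: "partial_deriv i (partial_deriv j (\<lambda>v. f v + g v)) v
      = partial_deriv i (partial_deriv j f) v + partial_deriv i (partial_deriv j g) v" if "v \<in> U" for v i j
    using f g that by (subst partial_deriv_cong[OF U that *], simp, subst partial_deriv_add)
      (auto simp: twice_differentiable_on_def)
  show "twice_differentiable_on U (\<lambda>v. f v + g v)"
    using f g differentiable_cong_open[OF U _ *] by (auto simp: twice_differentiable_on_def)
  show "second_order_op a b (\<lambda>v. f v + g v) u = second_order_op a b f u + second_order_op a b g u" if "u \<in> U"
    using that by (simp add: second_order_op_def * ** scaleR_add_right sum.distrib)
qed

lemma twice_differentiable_on_cmult:
  fixes f :: "real^'n::finite \<Rightarrow> real"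
  assumes U: "open U" and f: "twice_differentiable_on U f"
  shows "twice_differentiable_on U (\<lambda>v. c * f v)"
    and "u \<in> U \<Longrightarrow> second_order_op a b (\<lambda>v. c * f v) u = c * second_order_op a b f u"
proof -
  have m: "partial_deriv j (\<lambda>v. c * h v) v = c * partial_deriv j h v" if "h differentiable (at v)" for h :: "real^'n \<Rightarrow> real" and v j
    using partial_deriv_scaleR[of "\<lambda>_. c" v h j] that
    by (simp add: partial_deriv_def)
  have *: "partial_deriv j (\<lambda>v. c * f v) v = c * partial_deriv j f v" if "v \<in> U" for v j
    using f that by (intro m) (auto simp: twice_differentiable_on_def)
  have **: "partial_deriv i (partial_deriv j (\<lambda>v. c * f v)) v
      = c * partial_deriv i (partial_deriv j f) v" if "v \<in> U" for v i j
    using f that by (subst partial_deriv_cong[OF U that *], simp, subst m)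
      (auto simp: twice_differentiable_on_def)
  show "twice_differentiable_on U (\<lambda>v. c * f v)"
    using f differentiable_cong_open[OF U _ *] by (auto simp: twice_differentiable_on_def)
  show "second_order_op a b (\<lambda>v. c * f v) u = c * second_order_op a b f u" if "u \<in> U"
    using that by (simp add: second_order_op_def * ** sum_distrib_left distrib_left mult_ac)
qed

section \<open>The strong maximum principle\<close>

text \<open>The barrier of Hopf's argument: in \<open>\<psi> + \<alpha> \<psi>\<^sup>2\<close> the square contributes the gradient term
  \<open>2 \<alpha> a(\<nabla>\<psi>, \<nabla>\<psi>)\<close>, which dominates for large \<open>\<alpha>\<close>.\<close>
lemma barrier:
  fixes c :: "real^'n::finite" and \<rho> \<alpha> :: real
  defines "\<psi> \<equiv> \<lambda>u. \<rho>\<^sup>2 - (u - c) \<bullet> (u - c)"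
  defines "h \<equiv> \<lambda>u. \<psi> u + \<alpha> * (\<psi> u)\<^sup>2"
  shows "twice_differentiable_on U h"
    and "second_order_op a b h u =
      - 2 * (1 + 2 * \<alpha> * \<psi> u) * ((\<Sum>i\<in>UNIV. a u $ i $ i) + (\<Sum>j\<in>UNIV. b u $ j * (u - c) $ j)) +
      8 * \<alpha> * (\<Sum>i\<in>UNIV. \<Sum>j\<in>UNIV. a u $ i $ j * (u - c) $ i * (u - c) $ j)"
proof -
  have d: "(\<psi> has_derivative (\<lambda>v. - 2 * ((u - c) \<bullet> v))) (at u)" for u
    unfolding \<psi>_def by (auto intro!: derivative_eq_intros simp: inner_commute)
  have dh: "(h has_derivative (\<lambda>v. (1 + 2 * \<alpha> * \<psi> u) * (- 2 * ((u - c) \<bullet> v)))) (at u)" for u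
    unfolding h_def by (rule has_derivative_eq_rhs, (rule derivative_intros d)+)
       (simp add: algebra_simps)
  have 1: "partial_deriv j h = (\<lambda>u. (1 + 2 * \<alpha> * \<psi> u) * (- 2 * (u - c) $ j))" for j
    by (rule ext, subst partial_deriv_eq[OF dh]) (simp add: inner_axis)
  have d2: "((\<lambda>u. (1 + 2 * \<alpha> * \<psi> u) * (- 2 * (u - c) $ j)) has_derivative
      (\<lambda>v. (1 + 2 * \<alpha> * \<psi> u) * (- 2 * v $ j) + 2 * \<alpha> * (- 2 * ((u - c) \<bullet> v)) * (- 2 * (u - c) $ j))) (at u)" for u j
    by (rule has_derivative_eq_rhs, (rule derivative_intros d bounded_linear_vec_nth[THEN bounded_linear.has_derivative])+)
       (simp add: algebra_simps)
  show "twice_differentiable_on U h"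
    unfolding twice_differentiable_on_def 1 using dh d2 by (auto simp: differentiable_def)
  have 2: "partial_deriv i (partial_deriv j h) u =
    (1 + 2 * \<alpha> * \<psi> u) * (if i = j then - 2 else 0) + 8 * \<alpha> * (u - c) $ i * (u - c) $ j" for i j

  proof -
    have "axis i (1::real) $ j = (if i = j then 1 else 0)" by (simp add: axis_def)
    then show ?thesis unfolding 1 by (subst partial_deriv_eq[OF d2]) (simp add: inner_axis algebra_simps)
  qed
  show "second_order_op a b h u =
      - 2 * (1 + 2 * \<alpha> * \<psi> u) * ((\<Sum>i\<in>UNIV. a u $ i $ i) + (\<Sum>j\<in>UNIV. b u $ j * (u - c) $ j)) +
      8 * \<alpha> * (\<Sum>i\<in>UNIV. \<Sum>j\<in>UNIV. a u $ i $ j * (u - c) $ i * (u - c) $ j)"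
  proof -
    define k where "k = 1 + 2 * \<alpha> * \<psi> u"
    define w where "w = u - c"
    have "a u $ i $ j * (k * (if i = j then - 2 else 0) + 8 * \<alpha> * w $ i * w $ j) =
        (if i = j then - 2 * k * a u $ i $ j else 0) + 8 * \<alpha> * (a u $ i $ j * w $ i * w $ j)" for i j
      by (simp add: algebra_simps)
    then show ?thesis
      unfolding second_order_op_def 2 unfolding 1 k_def[symmetric] w_def[symmetric]
      by (simp add: sum.distrib sum_distrib_left sum_subtractf sum_negf algebra_simps)
  qed
qed

text \<open>The quadratic form is the squared norm of \<open>transpose V *v x\<close>, and
  \<open>transpose V\<close> is injective.\<close>

lemma positive_definite_VVt:
  fixes V :: "real^'n::finite^'n"
  assumes "invertible V" "x \<noteq> 0"
  shows "(\<Sum>i\<in>UNIV. \<Sum>j\<in>UNIV. (V ** transpose V) $ i $ j * x $ i * x $ j) > 0"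
proof -
  have "invertible (transpose V)" using assms(1) by (rule transpose_invertible)
  then have "transpose V *v x \<noteq> 0"
    using assms(2) by (metis invertible_def matrix_vector_mul_assoc matrix_vector_mul_lid matrix_vector_mult_0_right)
  then have "0 < (transpose V *v x) \<bullet> (transpose V *v x)" by simp
  also have "\<dots> = x \<bullet> ((V ** transpose V) *v x)"
    by (metis dot_lmul_matrix matrix_vector_mul_assoc transpose_matrix_vector)
  also have "\<dots> = (\<Sum>i\<in>UNIV. \<Sum>j\<in>UNIV. (V ** transpose V) $ i $ j * x $ i * x $ j)"
    by (simp add: inner_vec_def matrix_vector_mult_def sum_distrib_left mult_ac)
  finally show ?thesis .
qed

text \<open>A ball around a point \<open>q\<close> outside \<open>K\<close>, grown until it meets
  \<open>K\<close>, may touch \<open>K\<close> at many points. The ball of half the radius around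
  the midpoint of \<open>q\<close> and one nearest point \<open>p'\<close> is internally tangent to
  it at \<open>p'\<close> and meets \<open>K\<close> only there.\<close>

lemma interior_sphere_touching:
  fixes K :: "'a::euclidean_space set"
  assumes U: "open U" and K: "closedin (top_of_set U) K" and "\<not> open K"
  obtains p c \<rho> where "\<rho> > 0" "p \<in> K" "dist c p = \<rho>" "cball c \<rho> \<subseteq> U" "cball c \<rho> \<inter> K = {p}"
proof -
  have KU: "K \<subseteq> U" using K closedin_imp_subset by auto
  obtain p where p: "p \<in> K" "\<And>e. e > 0 \<Longrightarrow> \<not> ball p e \<subseteq> K"
    using assms(3) unfolding open_contains_ball by blast
  \<comment> \<open>The point \<open>q\<close> will lie within \<open>e\<close> of \<open>p\<close>,
    so a nearest point is at distance less than \<open>e\<close> from \<open>q\<close>. Cutting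
    \<open>K\<close> with \<open>cball p (2 * e)\<close> therefore loses no competitor and gives
    compactness.\<close>
  obtain e where e: "e > 0" "cball p (2 * e) \<subseteq> U"
  proof -
    obtain d where "d > 0" "cball p d \<subseteq> U"
      using U p(1) KU open_contains_cball by blast
    then show ?thesis using that[of "d / 2"] by auto
  qed
  obtain q where q: "q \<in> ball p e" "q \<notin> K" using p(2)[OF e(1)] by blast
  define K' where "K' = K \<inter> cball p (2 * e)"
  have "compact K'"
  proof -
    obtain T where "closed T" "K = U \<inter> T" using K by (auto simp: closedin_closed)
    then have "K' = T \<inter> cball p (2 * e)" using e(2) by (auto simp: K'_def)
    then show ?thesis using \<open>closed T\<close> by (simp add: closed_Int_compact)
  qed
  moreover have "p \<in> K'" using p(1) e(1) by (simp add: K'_def)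
  ultimately obtain p' where p': "p' \<in> K'" "\<And>y. y \<in> K' \<Longrightarrow> dist q p' \<le> dist q y"
    using distance_attains_inf[of K' q] compact_imp_closed by (metis empty_iff)
  define \<rho> where "\<rho> = dist q p'"
  have \<rho>: "\<rho> > 0" "\<rho> < e"
    using p'(1) q(2) p'(2)[OF \<open>p \<in> K'\<close>] q(1) by (auto simp: \<rho>_def K'_def dist_commute)
  define c where "c = midpoint q p'"
  have c: "dist c p' = \<rho> / 2" by (simp add: c_def \<rho>_def dist_midpoint)
  \<comment> \<open>A point of the small ball outside \<open>ball q \<rho>\<close> is an equality
    case of the triangle inequality through \<open>c\<close>, which leaves only the reflection of
    \<open>q\<close> in \<open>c\<close>, that is \<open>p'\<close>.\<close>
  have in_ball: "y \<in> ball q \<rho> \<or> y = p'" if "y \<in> cball c (\<rho> / 2)" for y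
  proof (rule ccontr)
    assume "\<not> ?thesis"
    then have n: "norm (y - q) \<ge> \<rho>" "y \<noteq> p'" by (auto simp: dist_norm norm_minus_commute)
    have "norm (y - c) \<le> \<rho> / 2"
      using that by (simp add: dist_norm norm_minus_commute)
    moreover have "norm (c - q) = \<rho> / 2"
      unfolding \<rho>_def c_def by (metis dist_midpoint(1) dist_norm dist_commute)
    moreover have "norm (y - q) \<le> norm (y - c) + norm (c - q)"
      using norm_triangle_ineq[of "y - c" "c - q"] by simp
    ultimately have eq: "norm ((y - c) + (c - q)) = norm (y - c) + norm (c - q)" "norm (y - c) = norm (c - q)"
      using n by auto
    then have "y - c = c - q"

      using eq(1)[unfolded norm_triangle_eq] eq(2) \<rho>(1) \<open>norm (c - q) = \<rho> / 2\<close> by simp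
    then have "y = 2 *\<^sub>R c - q" by (simp add: scaleR_2 algebra_simps)
    then show False using n(2) by (simp add: c_def midpoint_def)
  qed
  have sub: "cball c (\<rho> / 2) \<subseteq> cball p (2 * e)"
  proof
    fix y assume "y \<in> cball c (\<rho> / 2)"
    then have "dist q y \<le> \<rho>" using in_ball[of y] by (auto simp: \<rho>_def)
    then show "y \<in> cball p (2 * e)"
      using q(1) \<rho> dist_triangle[of p y q] by simp
  qed
  have "cball c (\<rho> / 2) \<inter> K = {p'}"
  proof (intro equalityI subsetI)
    fix y assume y: "y \<in> cball c (\<rho> / 2) \<inter> K"
    then have "y \<in> K'" using sub by (auto simp: K'_def)
    then show "y \<in> {p'}" using p'(2)[of y] in_ball[of y] y by (auto simp: \<rho>_def)
  qed (use c p' in \<open>auto simp: K'_def\<close>)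
  then show ?thesis
    using that[of "\<rho> / 2" p' c] \<rho> c sub e(2) p' by (auto simp: K'_def)
qed

lemma compact_small_perturbation:
  fixes f h :: "'a::topological_space \<Rightarrow> real"
  assumes "compact T" "continuous_on T f" "continuous_on T h" "\<And>x. x \<in> T \<Longrightarrow> f x < M"
  shows "\<exists>\<epsilon>>0. \<forall>x\<in>T. f x + \<epsilon> * h x < M"
proof (cases "T = {}")
  case True
  then show ?thesis by (auto intro: exI[of _ 1])
next
  case False
  obtain x0 where x0: "x0 \<in> T" "\<And>x. x \<in> T \<Longrightarrow> f x \<le> f x0"
    using continuous_attains_sup[OF assms(1) False assms(2)] by blast
  obtain x1 where x1: "x1 \<in> T" "\<And>x. x \<in> T \<Longrightarrow> h x \<le> h x1"
    using continuous_attains_sup[OF assms(1) False assms(3)] by blast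
  \<comment> \<open>The gap between \<open>M\<close> and the maximum of \<open>f\<close>, divided by
    a bound for \<open>h\<close>; the summand 1 keeps the denominator positive and the bound
    strict.\<close>
  define \<epsilon> where "\<epsilon> = (M - f x0) / (\<bar>h x1\<bar> + 1)"
  have \<epsilon>: "\<epsilon> > 0" using assms(4)[OF x0(1)] by (simp add: \<epsilon>_def)
  have "f x + \<epsilon> * h x < M" if "x \<in> T" for x
  proof -
    have "\<epsilon> * h x < \<epsilon> * (\<bar>h x1\<bar> + 1)"
      using \<epsilon> x1(2)[OF that] by (intro mult_strict_left_mono) auto
    also have "\<dots> = M - f x0" by (simp add: \<epsilon>_def)
    finally show ?thesis using x0(2)[OF that] by simp
  qed
  with \<epsilon> show ?thesis by blast
qed

text \<open>If the set were not open, a ball would touch it from outside at a single point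
  \<open>p\<close>. Adding a small multiple of Hopf's barrier pushes \<open>f\<close> strictly below
  \<open>M\<close> on a small sphere around \<open>p\<close> and keeps the value \<open>M\<close> at
  \<open>p\<close>. The interior maximum so created contradicts the second derivative test, because
  the operator is positive on the perturbed function.\<close>

lemma strong_maximum_principle:
  fixes f :: "real^'n::finite \<Rightarrow> real"
  assumes U: "open U"
    and a: "continuous_on U a" "\<And>u. u \<in> U \<Longrightarrow> \<exists>V :: real^'n^'n. invertible V \<and> a u = V ** transpose V"
    and b: "continuous_on U b"
    and f: "twice_differentiable_on U f"
    and sub: "\<And>u. u \<in> U \<Longrightarrow> second_order_op a b f u \<ge> 0"
    and le: "\<And>u. u \<in> U \<Longrightarrow> f u \<le> M"
  shows "open {u \<in> U. f u = M}"
proof (rule ccontr)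
  assume not_open: "\<not> ?thesis"
  have cf: "continuous_on U f"
    using f U by (meson twice_differentiable_on_def differentiable_imp_continuous_within continuous_at_imp_continuous_on)
  have "closedin (top_of_set U) {u \<in> U. f u = M}"
    using continuous_closedin_preimage_constant[OF cf] .
  then obtain p c \<rho> where \<rho>: "\<rho> > 0" "dist c p = \<rho>" "cball c \<rho> \<subseteq> U"
      and p: "p \<in> U" "f p = M" and touch: "cball c \<rho> \<inter> {u \<in> U. f u = M} = {p}"
    by (rule interior_sphere_touching[OF U _ not_open]) auto
  define \<psi> where "\<psi> u = \<rho>\<^sup>2 - (u - c) \<bullet> (u - c)" for u
  define Q where "Q u = (\<Sum>i\<in>UNIV. \<Sum>j\<in>UNIV. a u $ i $ j * (u - c) $ i * (u - c) $ j)" for u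
  define R where "R u = (\<Sum>i\<in>UNIV. a u $ i $ i) + (\<Sum>j\<in>UNIV. b u $ j * (u - c) $ j)" for u
  have \<psi>p: "\<psi> p = 0"
    using \<rho>(2) by (simp add: \<psi>_def dist_norm norm_minus_commute flip: power2_norm_eq_inner)
  have Qp: "Q p > 0"
  proof -
    obtain V :: "real^'n^'n" where "invertible V" "a p = V ** transpose V" using a(2) p(1) by blast
    moreover have "p - c \<noteq> 0" using \<rho> by auto
    ultimately show ?thesis using positive_definite_VVt[of V "p - c"] by (simp add: Q_def)
  qed
  \<comment> \<open>Chosen such that \<open>8 * \<alpha> * Q p\<close> equals
    \<open>2 * (\<bar>R p\<bar> + 1)\<close>, which outweighs the other term
    \<open>- 2 * R p\<close> of \<open>L p\<close>.\<close>
  define \<alpha> where "\<alpha> = (\<bar>R p\<bar> + 1) / (4 * Q p)"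
  have \<alpha>: "\<alpha> > 0" using Qp by (simp add: \<alpha>_def)
  \<comment> \<open>The second order Taylor polynomial in \<psi> of (exp(2 \<alpha> \<psi>) - 1) /
    (2 \<alpha>), the classical exponential barrier up to a positive factor. It factors as \<psi> (1
    + \<alpha> \<psi>), so it has the sign of \<psi> wherever the second factor is positive.\<close>
  define h where "h u = \<psi> u + \<alpha> * (\<psi> u)\<^sup>2" for u
  have h: "twice_differentiable_on U h"
    using barrier(1)[of U \<rho> c \<alpha>] by (simp add: h_def[abs_def] \<psi>_def[abs_def])
  define L where "L u = - 2 * (1 + 2 * \<alpha> * \<psi> u) * R u + 8 * \<alpha> * Q u" for u
  have Lh: "second_order_op a b h u = L u" for u
    using barrier(2)[of a b \<rho> c \<alpha> u]
    by (simp add: h_def[abs_def] \<psi>_def[abs_def] L_def R_def Q_def)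
  have Lp: "L p > 0"
    using Qp by (simp add: L_def \<psi>p \<alpha>_def field_simps abs_if)
  have "continuous_on U \<psi>" unfolding \<psi>_def by (intro continuous_intros)
  then have "continuous_on U (\<lambda>u. 1 + \<alpha> * \<psi> u)" by (intro continuous_intros)
  from continuous_open_preimage[OF this U open_greaterThan]
  have "open (U \<inter> (\<lambda>u. 1 + \<alpha> * \<psi> u) -` {0<..})" .
  moreover have "continuous_on U L"
    unfolding L_def Q_def R_def \<psi>_def by (intro continuous_intros a(1) b)
  from continuous_open_preimage[OF this U open_greaterThan]
  have "open (U \<inter> L -` {0<..})" .
  ultimately have "open ((U \<inter> L -` {0<..}) \<inter> (U \<inter> (\<lambda>u. 1 + \<alpha> * \<psi> u) -` {0<..}))" by (simp only: open_Int)
  moreover have "p \<in> (U \<inter> L -` {0<..}) \<inter> (U \<inter> (\<lambda>u. 1 + \<alpha> * \<psi> u) -` {0<..})"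
    using p Lp \<psi>p by simp
  ultimately obtain \<delta> where \<delta>: "\<delta> > 0"
      "cball p \<delta> \<subseteq> (U \<inter> L -` {0<..}) \<inter> (U \<inter> (\<lambda>u. 1 + \<alpha> * \<psi> u) -` {0<..})"
    unfolding open_contains_cball by blast
  then have in_cball: "u \<in> U" "L u > 0" "1 + \<alpha> * \<psi> u > 0" if "u \<in> cball p \<delta>" for u
    using that by auto
  have ch: "continuous_on U h" unfolding h_def \<psi>_def by (intro continuous_intros)
  \<comment> \<open>Inside \<open>cball c \<rho>\<close> the barrier may be positive, but on this
    compact part of the sphere \<open>f\<close> stays strictly below \<open>M\<close>, which leaves
    room for some \<open>\<epsilon>\<close>. On the remaining part the barrier itself is
    negative.\<close>
  have "continuous_on (sphere p \<delta> \<inter> cball c \<rho>) f" "continuous_on (sphere p \<delta> \<inter> cball c \<rho>) h"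
    using \<rho>(3) continuous_on_subset[OF cf] continuous_on_subset[OF ch] by (simp_all add: le_infI2)
  moreover have "f x < M" if "x \<in> sphere p \<delta> \<inter> cball c \<rho>" for x
  proof -
    have "x \<noteq> p" "x \<in> U" using that \<delta>(1) \<rho>(3) by auto
    then have "f x \<noteq> M" using that touch by blast
    then show ?thesis using le[OF \<open>x \<in> U\<close>] by simp
  qed
  ultimately have "\<exists>\<epsilon>>0. \<forall>x\<in>sphere p \<delta> \<inter> cball c \<rho>. f x + \<epsilon> * h x < M"
    by (rule compact_small_perturbation[OF compact_Int[OF compact_sphere compact_cball]])
  then obtain \<epsilon> where \<epsilon>: "\<epsilon> > 0" "\<And>x. x \<in> sphere p \<delta> \<inter> cball c \<rho> \<Longrightarrow> f x + \<epsilon> * h x < M"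
    by blast
  define w where "w x = f x + \<epsilon> * h x" for x
  have wp: "w p = M" by (simp add: w_def h_def \<psi>p p)
  have w_sphere: "w x < M" if "x \<in> sphere p \<delta>" for x
  proof (cases "x \<in> cball c \<rho>")
    case True
    then show ?thesis using \<epsilon>(2) that by (simp add: w_def)
  next
    case False
    then have "\<rho>\<^sup>2 < (norm (x - c))\<^sup>2"
      using \<rho>(1) by (intro power_strict_mono) (auto simp: dist_norm norm_minus_commute)
    then have "\<psi> x < 0" by (simp add: \<psi>_def power2_norm_eq_inner)
    moreover have "x \<in> cball p \<delta>" using that by simp
    ultimately have "\<psi> x * (1 + \<alpha> * \<psi> x) < 0" using in_cball(3) by (simp add: mult_less_0_iff)
    then have "h x < 0" by (simp add: h_def power2_eq_square algebra_simps)
    then have "\<epsilon> * h x < 0" using \<epsilon>(1) by (simp add: mult_less_0_iff)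
    then show ?thesis using le[OF in_cball(1)[OF \<open>x \<in> cball p \<delta>\<close>]] by (simp add: w_def)
  qed
  have cw: "continuous_on (cball p \<delta>) w"
    unfolding w_def using in_cball(1)
    by (intro continuous_intros continuous_on_subset[OF cf] continuous_on_subset[OF ch]) auto
  obtain x where x: "x \<in> cball p \<delta>" "\<And>y. y \<in> cball p \<delta> \<Longrightarrow> w y \<le> w x"
    using continuous_attains_sup[OF compact_cball _ cw] \<delta>(1) by (metis cball_eq_empty not_less_iff_gr_or_eq)
  have "w x \<ge> M" using x(2)[of p] \<delta>(1) wp by simp
  then have xb: "x \<in> ball p \<delta>" using w_sphere[of x] x(1) by (cases "dist p x = \<delta>") auto
  have eh: "twice_differentiable_on U (\<lambda>v. \<epsilon> * h v)" by (rule twice_differentiable_on_cmult(1)[OF U h])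
  have "twice_differentiable_on U w"
    unfolding w_def by (rule twice_differentiable_on_add(1)[OF U f eh])
  then have "twice_differentiable_on (ball p \<delta>) w"
    using in_cball(1) unfolding twice_differentiable_on_def by simp
  moreover obtain V :: "real^'n^'n" where "a x = V ** transpose V" using a(2) in_cball(1) x(1) by blast
  ultimately have "second_order_op a b w x \<le> 0"
    using x(2) xb by (intro second_order_op_nonpos_at_max[of "ball p \<delta>"]) auto
  moreover have "second_order_op a b w x = second_order_op a b f x + \<epsilon> * L x"
    unfolding w_def using in_cball(1)[OF x(1)]
    by (simp add: twice_differentiable_on_add(2)[OF U f eh] twice_differentiable_on_cmult(2)[OF U h] Lh)
  moreover have "\<epsilon> * L x > 0" using \<epsilon>(1) in_cball(2)[OF x(1)] by simp
  ultimately show False using sub[OF in_cball(1)[OF x(1)]] by simp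
qed

section \<open>The Laplacian of the position vector\<close>

lemma Ck_on_1I:
  assumes "\<And>u. u \<in> U \<Longrightarrow> (f has_derivative F u) (at u)"
    and "\<And>i. continuous_on U (\<lambda>u. F u (axis i 1))"
  shows "Ck_on (Suc 0) U f"
proof -
  have "continuous_on U (partial_deriv i f)" for i
    using assms(2)[of i] by (rule continuous_on_eq) (simp add: partial_deriv_eq[OF assms(1)])
  then show ?thesis using assms(1) by (auto simp: differentiable_def)
qed

lemma Ck_on_1D:
  assumes "Ck_on (Suc 0) U f"
  shows "u \<in> U \<Longrightarrow> (f has_derivative frechet_derivative f (at u)) (at u)"
    and "continuous_on U (\<lambda>u. frechet_derivative f (at u) (axis i 1))"
    and "continuous_on U f"
proof -
  show *: "(f has_derivative frechet_derivative f (at u)) (at u)" if "u \<in> U" for u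
    using assms that by (auto intro: has_derivative_frechet)
  show "continuous_on U (\<lambda>u. frechet_derivative f (at u) (axis i 1))"
    using assms by (simp add: partial_deriv_def[abs_def])
  show "continuous_on U f"
    using * by (meson continuous_at_imp_continuous_on has_derivative_continuous)
qed

lemma Ck_on_1_cong:
  assumes U: "open U" and f: "Ck_on (Suc 0) U f" and eq: "\<And>u. u \<in> U \<Longrightarrow> f u = g u"
  shows "Ck_on (Suc 0) U g"
  by (rule Ck_on_1I, rule has_derivative_transform_within_open[OF Ck_on_1D(1)[OF f] U _ eq])
     (assumption+, rule Ck_on_1D(2)[OF f])

declare Ck_on.simps(2) [simp del]

lemma Ck_on_1_const: "Ck_on (Suc 0) U (\<lambda>u. c)"
  by (rule Ck_on_1I) (auto intro: derivative_intros)

lemma Ck_on_1_add: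
  assumes "Ck_on (Suc 0) U f" "Ck_on (Suc 0) U g"
  shows "Ck_on (Suc 0) U (\<lambda>u. f u + g u)"
  by (rule Ck_on_1I, rule has_derivative_add[OF assms[THEN Ck_on_1D(1)]])
     (assumption+, intro continuous_intros assms[THEN Ck_on_1D(2)])

lemma Ck_on_1_mult:
  fixes f g :: "real^'n::finite \<Rightarrow> real"
  assumes "Ck_on (Suc 0) U f" "Ck_on (Suc 0) U g"
  shows "Ck_on (Suc 0) U (\<lambda>u. f u * g u)"
  by (rule Ck_on_1I, rule has_derivative_mult[OF assms[THEN Ck_on_1D(1)]])
     (assumption+, intro continuous_intros assms[THEN Ck_on_1D(2)] assms[THEN Ck_on_1D(3)])

lemma Ck_on_1_inner:
  fixes f g :: "real^'n::finite \<Rightarrow> 'b::real_inner"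
  assumes "Ck_on (Suc 0) U f" "Ck_on (Suc 0) U g"
  shows "Ck_on (Suc 0) U (\<lambda>u. f u \<bullet> g u)"
  by (rule Ck_on_1I, rule has_derivative_inner[OF assms[THEN Ck_on_1D(1)]])
     (assumption+, intro continuous_intros assms[THEN Ck_on_1D(2)] assms[THEN Ck_on_1D(3)])

lemma Ck_on_1_sum:
  assumes "\<And>i. i \<in> I \<Longrightarrow> Ck_on (Suc 0) U (f i)"
  shows "Ck_on (Suc 0) U (\<lambda>u. \<Sum>i\<in>I. f i u)"
  using assms by (induction I rule: infinite_finite_induct) (auto intro: Ck_on_1_const Ck_on_1_add)

lemma Ck_on_1_prod:
  fixes f :: "'i \<Rightarrow> real^'n::finite \<Rightarrow> real"
  assumes "\<And>i. i \<in> I \<Longrightarrow> Ck_on (Suc 0) U (f i)"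
  shows "Ck_on (Suc 0) U (\<lambda>u. \<Prod>i\<in>I. f i u)"
  using assms by (induction I rule: infinite_finite_induct) (auto intro: Ck_on_1_const Ck_on_1_mult)

lemma Ck_on_1_compose_real:
  fixes f :: "real^'n::finite \<Rightarrow> real"
  assumes f: "Ck_on (Suc 0) U f"
    and k: "\<And>u. u \<in> U \<Longrightarrow> (k has_real_derivative k' (f u)) (at (f u))" "continuous_on (f ` U) k'"
  shows "Ck_on (Suc 0) U (\<lambda>u. k (f u))"
proof (rule Ck_on_1I)
  show "((\<lambda>u. k (f u)) has_derivative (\<lambda>v. k' (f u) * frechet_derivative f (at u) v)) (at u)" if "u \<in> U" for u
    using has_derivative_compose[OF Ck_on_1D(1)[OF f that] k(1)[OF that, unfolded has_field_derivative_def]] .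
  show "continuous_on U (\<lambda>u. k' (f u) * frechet_derivative f (at u) (axis i 1))" for i
    by (intro continuous_intros Ck_on_1D(2)[OF f] continuous_on_compose2[OF k(2) Ck_on_1D(3)[OF f]]) auto
qed

lemma Ck_on_1_sqrt:
  fixes f :: "real^'n::finite \<Rightarrow> real"
  assumes "Ck_on (Suc 0) U f" "\<And>u. u \<in> U \<Longrightarrow> f u > 0"
  shows "Ck_on (Suc 0) U (\<lambda>u. sqrt (f u))"
proof (rule Ck_on_1_compose_real[where k = sqrt])
  show "(sqrt has_real_derivative inverse (sqrt (f u)) / 2) (at (f u))" if "u \<in> U" for u
    using assms(2)[OF that] by (rule DERIV_real_sqrt)
  show "continuous_on (f ` U) (\<lambda>x. inverse (sqrt x) / 2)"
    by (intro continuous_intros) (use assms(2) in force)+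
qed fact

lemma Ck_on_1_inverse:
  fixes f :: "real^'n::finite \<Rightarrow> real"
  assumes "Ck_on (Suc 0) U f" "\<And>u. u \<in> U \<Longrightarrow> f u \<noteq> 0"
  shows "Ck_on (Suc 0) U (\<lambda>u. inverse (f u))"
proof (rule Ck_on_1_compose_real[where k = inverse])
  show "(inverse has_real_derivative - (inverse (f u) ^ Suc (Suc 0))) (at (f u))" if "u \<in> U" for u
    using assms(2)[OF that] by (rule DERIV_inverse)
  show "continuous_on (f ` U) (\<lambda>x. - (inverse x ^ Suc (Suc 0)))"
    by (intro continuous_intros) (use assms(2) in force)+
qed fact

lemma Ck_on_1_det:
  fixes g :: "real^'n::finite \<Rightarrow> real^'k::finite^'k"
  assumes "\<And>i j. Ck_on (Suc 0) U (\<lambda>u. g u $ i $ j)"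
  shows "Ck_on (Suc 0) U (\<lambda>u. det (g u))"
  unfolding det_def by (intro Ck_on_1_sum Ck_on_1_mult Ck_on_1_prod Ck_on_1_const assms)

section \<open>Inverse matrices and Gram matrices\<close>

lemma matrix_inv_eqI:
  fixes A :: "'a::field^'n::finite^'n"
  assumes "B ** A = mat 1"
  shows "matrix_inv A = B"
proof -
  have "A ** matrix_inv A = mat 1 \<and> matrix_inv A ** A = mat 1"
    unfolding matrix_inv_def by (rule someI[of _ B]) (use assms matrix_left_right_inverse in blast)
  then have "B = B ** (A ** matrix_inv A)" by simp
  also have "\<dots> = matrix_inv A" by (simp add: matrix_mul_assoc assms)
  finally show ?thesis by simp
qed

text \<open>Column \<open>j\<close> of the inverse is mapped by \<open>A\<close> to
  \<open>axis j 1\<close>. Cramer's rule makes its entries quotients of determinants, so that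
  regularity passes from a matrix function to its inverse through \<open>det\<close>.\<close>

lemma matrix_inv_cramer:
  fixes A :: "'a::field^'n::finite^'n"
  assumes "det A \<noteq> 0"
  shows "matrix_inv A $ i $ j = det (\<chi> k l. if l = i then axis j 1 $ k else A $ k $ l) * inverse (det A)"
proof -
  obtain B where B: "A ** B = mat 1" "B ** A = mat 1"
    using assms invertible_det_nz[of A] unfolding invertible_def by blast
  have "A *v (B *v axis j 1) = axis j 1" by (simp add: matrix_vector_mul_assoc B)
  then have "(B *v axis j 1) $ i = det (\<chi> k l. if l = i then axis j 1 $ k else A $ k $ l) / det A"
    using cramer[OF assms, of "B *v axis j 1" "axis j 1"] by simp
  moreover have "(B *v axis j 1) $ i = B $ i $ j"
    by (simp add: matrix_vector_mult_def axis_def if_distrib cong: if_cong)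
  ultimately show ?thesis using matrix_inv_eqI[OF B(2)] by (simp add: field_simps)
qed

lemma Ck_on_1_matrix_inv:
  fixes g :: "real^'n::finite \<Rightarrow> real^'k::finite^'k"
  assumes "\<And>i j. Ck_on (Suc 0) U (\<lambda>u. g u $ i $ j)" "\<And>u. u \<in> U \<Longrightarrow> det (g u) > 0"
    and U: "open U"
  shows "Ck_on (Suc 0) U (\<lambda>u. matrix_inv (g u) $ i $ j)"
proof -
  have "Ck_on (Suc 0) U (\<lambda>u. (\<chi> k l. if l = i then axis j 1 $ k else g u $ k $ l :: real^'k^'k) $ k $ l)" for k l
    using assms(1) by (cases "l = i") (simp_all add: Ck_on_1_const)
  then have "Ck_on (Suc 0) U (\<lambda>u. det (\<chi> k l. if l = i then axis j 1 $ k else g u $ k $ l :: real^'k^'k))"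
    by (rule Ck_on_1_det)
  moreover have "Ck_on (Suc 0) U (\<lambda>u. inverse (det (g u)))"
    by (intro Ck_on_1_inverse Ck_on_1_det assms(1)) (use assms(2) in force)
  ultimately have "Ck_on (Suc 0) U
      (\<lambda>u. det (\<chi> k l. if l = i then axis j 1 $ k else g u $ k $ l :: real^'k^'k) * inverse (det (g u)))"
    by (rule Ck_on_1_mult)
  then show ?thesis
    by (rule Ck_on_1_cong[OF U]) (use assms(2) in \<open>simp add: matrix_inv_cramer less_imp_neq[symmetric]\<close>)
qed

text \<open>The columns of \<open>V\<close> are the preimages under \<open>J\<close> of an orthonormal basis of its range.\<close>
lemma gram_matrix_inverse:
  fixes J :: "real^'n::finite \<Rightarrow> 'b::euclidean_space"
  assumes "linear J" "inj J"
  defines "G \<equiv> \<chi> i j. J (axis i 1) \<bullet> J (axis j 1)"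
  obtains V :: "real^'n^'n" where "invertible V" "matrix_inv G = V ** transpose V" "V ** transpose V ** G = mat 1" "det G > 0"
proof -
  interpret J: linear J by fact
  have sub: "subspace (range J)" by (simp add: assms(1) linear_subspace_image)
  obtain B where B: "B \<subseteq> range J" "pairwise orthogonal B" "\<And>x. x \<in> B \<Longrightarrow> norm x = 1"
      "independent B" "card B = dim (range J)" "span B = range J"
    using orthonormal_basis_subspace[OF sub] by metis
  have finB: "finite B" using B(4) by (rule independent_imp_finite)
  have "card B = CARD('n)"
    using B(5) dim_image_eq[OF assms(1), of UNIV] assms(2) by simp
  then obtain e :: "'n \<Rightarrow> 'b" where e: "bij_betw e UNIV B"
    using finite_same_card_bij[of "UNIV :: 'n set" B] finB by auto
  have "\<forall>k. \<exists>v. J v = e k" using B(1) e by (metis bij_betw_apply UNIV_I imageE subsetD)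
  then obtain v where v: "\<And>k. J (v k) = e k" by metis
  \<comment> \<open>In matrix form this identity is \<open>V ** (transpose V ** G) = mat 1\<close>:
    the entries of \<open>transpose V ** G\<close> are the coefficients of the vectors
    \<open>J (axis j 1)\<close> in the orthonormal basis.\<close>
  have expand: "(\<Sum>k\<in>UNIV. (J x \<bullet> e k) *\<^sub>R v k) = x" for x
  proof (rule injD[OF assms(2)])
    have "J (\<Sum>k\<in>UNIV. (J x \<bullet> e k) *\<^sub>R v k) = (\<Sum>k\<in>UNIV. (J x \<bullet> e k) *\<^sub>R e k)"
      by (simp add: J.sum J.scaleR v)
    also have "\<dots> = (\<Sum>b\<in>B. (J x \<bullet> b) *\<^sub>R b)" by (rule sum.reindex_bij_betw[OF e])
    also have "\<dots> = J x" using B finB by (intro orthonormal_basis_expand) auto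
    finally show "J (\<Sum>k\<in>UNIV. (J x \<bullet> e k) *\<^sub>R v k) = J x" .
  qed
  define V where "V = (\<chi> i k. v k $ i)"
  have *: "(transpose V ** G) $ k $ j = J (axis j 1) \<bullet> e k" for k j
  proof -
    have "(transpose V ** G) $ k $ j = J (\<Sum>l\<in>UNIV. v k $ l *\<^sub>R axis l 1) \<bullet> J (axis j 1)"
      by (simp add: matrix_matrix_mult_def transpose_def V_def G_def J.sum J.scaleR inner_sum_left)
    also have "(\<Sum>l\<in>UNIV. v k $ l *\<^sub>R axis l 1) = v k"
      by (simp add: basis_expansion flip: scalar_mult_eq_scaleR)
    finally show ?thesis by (simp add: v inner_commute)
  qed
  have mm: "(V ** M) $ i $ j = (\<Sum>k\<in>UNIV. V $ i $ k * M $ k $ j)" for M :: "real^'n^'n" and i j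
    by (simp add: matrix_matrix_mult_def)
  have "(V ** (transpose V ** G)) $ i $ j = (\<Sum>k\<in>UNIV. (J (axis j 1) \<bullet> e k) *\<^sub>R v k) $ i" for i j
    unfolding mm * by (simp add: V_def mult.commute)
  then have 1: "V ** (transpose V ** G) = mat 1"
    unfolding expand by (simp add: vec_eq_iff mat_def axis_def)
  then have inv: "V ** transpose V ** G = mat 1" by (simp add: matrix_mul_assoc)
  \<comment> \<open>A square times \<open>det G\<close> is positive, which settles the sign of
    \<open>det G\<close>.\<close>
  have "det V * det V * det G = 1"
    using arg_cong[OF inv, of det] by (simp add: det_mul)
  then have "det G > 0" by (metis not_square_less_zero zero_less_mult_iff zero_less_one not_less)
  moreover have "invertible V" using 1 invertible_right_inverse by blast
  ultimately show ?thesis using that inv matrix_inv_eqI[OF inv] by blast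
qed

text \<open>By the product rule, derivatives falling on the weights become the drift, while in the
  leading part the factor \<open>sqrt (det (g u))\<close> cancels.\<close>

lemma laplace_beltrami_expand:
  fixes g :: "real^'n::finite \<Rightarrow> real^'n^'n" and h :: "real^'n \<Rightarrow> 'b::real_normed_vector"
  assumes "\<And>i j. Ck_on (Suc 0) U (\<lambda>u. sqrt (det (g u)) * matrix_inv (g u) $ i $ j)"
    and det: "\<And>u. u \<in> U \<Longrightarrow> det (g u) > 0" and h: "twice_differentiable_on U h" and u: "u \<in> U"
  shows "laplace_beltrami g h u = second_order_op (\<lambda>u. matrix_inv (g u))
    (\<lambda>u. \<chi> j. (1 / sqrt (det (g u))) *
       (\<Sum>i\<in>UNIV. partial_deriv i (\<lambda>v. sqrt (det (g v)) * matrix_inv (g v) $ i $ j) u)) h u"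
proof -
  define s where "s u = sqrt (det (g u))" for u
  define A where "A i j v = s v * matrix_inv (g v) $ i $ j" for i j v
  have dA: "A i j differentiable (at u)" for i j
    using Ck_on_1D(1)[OF assms(1) u] unfolding A_def[abs_def] s_def by (auto simp: differentiable_def)
  have dh: "partial_deriv j h differentiable (at u)" for j
    using h u by (simp add: twice_differentiable_on_def)
  have s: "s u \<noteq> 0" using det[OF u] by (simp add: s_def)
  have "partial_deriv i (\<lambda>v. \<Sum>j\<in>UNIV. A i j v *\<^sub>R partial_deriv j h v) u =
      (\<Sum>j\<in>UNIV. A i j u *\<^sub>R partial_deriv i (partial_deriv j h) u + partial_deriv i (A i j) u *\<^sub>R partial_deriv j h u)" for i
    using dA dh by (subst partial_deriv_sum) (simp_all add: partial_deriv_scaleR)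
  then have "laplace_beltrami g h u = (1 / s u) *\<^sub>R (\<Sum>i\<in>UNIV. \<Sum>j\<in>UNIV.
      A i j u *\<^sub>R partial_deriv i (partial_deriv j h) u + partial_deriv i (A i j) u *\<^sub>R partial_deriv j h u)"
    by (simp add: laplace_beltrami_def A_def s_def)
  also have "\<dots> = (\<Sum>i\<in>UNIV. \<Sum>j\<in>UNIV. ((1 / s u) * A i j u) *\<^sub>R partial_deriv i (partial_deriv j h) u) +
      (\<Sum>j\<in>UNIV. (1 / s u * (\<Sum>i\<in>UNIV. partial_deriv i (A i j) u)) *\<^sub>R partial_deriv j h u)"
    by (simp only: sum.distrib scaleR_add_right scaleR_sum_right scaleR_sum_left scaleR_scaleR sum_distrib_left)
       (rule arg_cong2[of _ _ _ _ "(+)", OF refl sum.swap])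
  also have "(\<lambda>i j. (1 / s u) * A i j u) = (\<lambda>i j. matrix_inv (g u) $ i $ j)"
    using s by (simp add: A_def)
  finally show ?thesis
    by (simp add: second_order_op_def A_def[abs_def] s_def fun_eq_iff)
qed

section \<open>Metric, Laplacian and tangent space in a chart\<close>

lemma local_parametrizationD:
  assumes "local_parametrization \<Sigma> U \<phi>"
  shows "open U" "twice_differentiable_on U \<phi>" "\<And>j. Ck_on (Suc 0) U (partial_deriv j \<phi>)"
    "\<And>u. u \<in> U \<Longrightarrow> inj (frechet_derivative \<phi> (at u))" "\<phi> ` U \<subseteq> \<Sigma>"
    "\<And>W. open W \<Longrightarrow> W \<subseteq> U \<Longrightarrow> openin (top_of_set \<Sigma>) (\<phi> ` W)"
proof -
  note lp = assms[unfolded local_parametrization_def]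
  show "open U" using lp by simp
  have "Ck_on (Suc (Suc 0)) U \<phi>" using lp unfolding smooth_on_def by blast
  then show "Ck_on (Suc 0) U (partial_deriv j \<phi>)" "twice_differentiable_on U \<phi>" for j
    by (auto simp: Ck_on.simps(2) twice_differentiable_on_def)
  show "inj (frechet_derivative \<phi> (at u))" if "u \<in> U" for u using lp that by simp
  show "\<phi> ` U \<subseteq> \<Sigma>" using lp openin_imp_subset by blast
  show "openin (top_of_set \<Sigma>) (\<phi> ` W)" if W: "open W" "W \<subseteq> U" for W
  proof -
    obtain \<psi> where \<psi>: "homeomorphism U (\<phi> ` U) \<phi> \<psi>" using lp by blast
    have "openin (top_of_set U) W" using W by (simp add: open_subset)
    then have "openin (top_of_set (\<phi> ` U)) (\<phi> ` W)"
      by (rule homeomorphism_imp_open_map[OF \<psi>])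
    then show ?thesis using lp openin_trans by blast
  qed
qed

lemma frechet_derivative_axis:
  "frechet_derivative \<phi> (at u) (axis i 1) = partial_deriv i \<phi> u"
  by (simp add: partial_deriv_def)

text \<open>The metric is the Gram matrix of the injective derivative of the chart on the standard
  basis.\<close>

lemma induced_metric_inverse:
  assumes "local_parametrization \<Sigma> U (\<phi> :: real^'n::finite \<Rightarrow> real^'m::finite)" "u \<in> U"
  obtains V :: "real^'n^'n" where "invertible V" "matrix_inv (induced_metric \<phi> u) = V ** transpose V"
    "matrix_inv (induced_metric \<phi> u) ** induced_metric \<phi> u = mat 1" "det (induced_metric \<phi> u) > 0"
proof -
  note lp = local_parametrizationD[OF assms(1)]
  have "(\<phi> has_derivative frechet_derivative \<phi> (at u)) (at u)"
    using lp(2) assms(2) by (auto simp: twice_differentiable_on_def has_derivative_frechet)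
  then have "linear (frechet_derivative \<phi> (at u))" by (rule has_derivative_linear)
  from gram_matrix_inverse[OF this lp(4)[OF assms(2)]] obtain V :: "real^'n^'n" where
    "invertible V" "matrix_inv (induced_metric \<phi> u) = V ** transpose V"
    "V ** transpose V ** induced_metric \<phi> u = mat 1" "det (induced_metric \<phi> u) > 0"
    unfolding frechet_derivative_axis induced_metric_def by metis
  then show ?thesis using that[of V] by simp
qed

text \<open>Provides the continuity that the strong maximum principle asks of its coefficients. The
  drift contains one derivative of the metric, and the metric is built from first derivatives of the
  smooth chart.\<close>

lemma laplace_beltrami_chart:
  assumes "local_parametrization \<Sigma> U (\<phi> :: real^'n::finite \<Rightarrow> real^'m::finite)"
  defines "a \<equiv> \<lambda>u. matrix_inv (induced_metric \<phi> u)"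
  obtains b where "continuous_on U a" "continuous_on U b"
    "\<And>u. u \<in> U \<Longrightarrow> laplace_beltrami (induced_metric \<phi>) \<phi> u = second_order_op a b \<phi> u"
proof -
  note lp = local_parametrizationD[OF assms(1)]
  define g where "g = induced_metric \<phi>"
  have det: "det (g u) > 0" if "u \<in> U" for u
    using induced_metric_inverse[OF assms(1) that] unfolding g_def by blast
  have "Ck_on (Suc 0) U (\<lambda>u. partial_deriv i \<phi> u \<bullet> partial_deriv j \<phi> u)" for i j
    by (rule Ck_on_1_inner[OF lp(3) lp(3)])
  then have g: "Ck_on (Suc 0) U (\<lambda>u. g u $ i $ j)" for i j
    by (simp add: g_def induced_metric_def)
  have s: "Ck_on (Suc 0) U (\<lambda>u. sqrt (det (g u)))"
    by (rule Ck_on_1_sqrt[OF Ck_on_1_det[OF g] det])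
  have gi: "Ck_on (Suc 0) U (\<lambda>u. matrix_inv (g u) $ i $ j)" for i j
    by (rule Ck_on_1_matrix_inv[OF g det lp(1)])
  have A: "Ck_on (Suc 0) U (\<lambda>u. sqrt (det (g u)) * matrix_inv (g u) $ i $ j)" for i j
    by (rule Ck_on_1_mult[OF s gi])
  define b where "b u = (\<chi> j. (1 / sqrt (det (g u))) *
       (\<Sum>i\<in>UNIV. partial_deriv i (\<lambda>v. sqrt (det (g v)) * matrix_inv (g v) $ i $ j) u))" for u
  have "continuous_on U (\<lambda>u. \<chi> i j. matrix_inv (g u) $ i $ j)"
    by (intro continuous_on_vec_lambda Ck_on_1D(3)[OF gi])
  then have "continuous_on U a" by (simp add: a_def g_def)
  moreover have "continuous_on U b"
    unfolding b_def using A det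
    by (intro continuous_intros continuous_on_vec_lambda Ck_on_1D(3)[OF s])
       (auto simp: Ck_on.simps less_imp_neq[symmetric])
  moreover have "laplace_beltrami g \<phi> u = second_order_op a b \<phi> u" if "u \<in> U" for u
    unfolding a_def b_def g_def[symmetric] by (rule laplace_beltrami_expand[OF A det lp(2) that])
  ultimately show ?thesis using that by (simp add: g_def)
qed

lemma second_order_op_inner_self:
  fixes \<phi> :: "real^'n::finite \<Rightarrow> 'b::real_inner"
  assumes U: "open U" and \<phi>: "twice_differentiable_on U \<phi>"
  shows "twice_differentiable_on U (\<lambda>u. \<phi> u \<bullet> \<phi> u)"
    and "u \<in> U \<Longrightarrow> second_order_op a b (\<lambda>u. \<phi> u \<bullet> \<phi> u) u = 2 * (\<phi> u \<bullet> second_order_op a b \<phi> u) +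
      2 * (\<Sum>i\<in>UNIV. \<Sum>j\<in>UNIV. a u $ i $ j * (partial_deriv i \<phi> u \<bullet> partial_deriv j \<phi> u))"
proof -
  have d: "\<phi> differentiable (at v)" "partial_deriv j \<phi> differentiable (at v)" if "v \<in> U" for v j
    using \<phi> that by (auto simp: twice_differentiable_on_def)
  have 1: "partial_deriv j (\<lambda>u. \<phi> u \<bullet> \<phi> u) v = (2 *\<^sub>R \<phi> v) \<bullet> partial_deriv j \<phi> v" if "v \<in> U" for v j
    using partial_deriv_inner[OF d(1) d(1), OF that that] by (simp add: inner_commute)
  have d2: "(\<lambda>v. 2 *\<^sub>R \<phi> v) differentiable (at v)" if "v \<in> U" for v
    using d(1)[OF that] by simp
  have "(\<lambda>v. (2 *\<^sub>R \<phi> v) \<bullet> partial_deriv j \<phi> v) differentiable (at v)" if "v \<in> U" for v j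
    using has_derivative_inner[OF has_derivative_frechet[OF d2] has_derivative_frechet[OF d(2)], OF that that]
    unfolding differentiable_def by blast
  then show "twice_differentiable_on U (\<lambda>u. \<phi> u \<bullet> \<phi> u)"
    using differentiable_cong_open[OF U _ 1] d(1) unfolding twice_differentiable_on_def
    by (auto intro!: differentiable_inner)
  have 2: "partial_deriv i (partial_deriv j (\<lambda>u. \<phi> u \<bullet> \<phi> u)) v =
      2 * (\<phi> v \<bullet> partial_deriv i (partial_deriv j \<phi>) v) + 2 * (partial_deriv i \<phi> v \<bullet> partial_deriv j \<phi> v)" if "v \<in> U" for i j v
  proof -
    have "partial_deriv i (\<lambda>v. 2 *\<^sub>R \<phi> v) v = 2 *\<^sub>R partial_deriv i \<phi> v"
      using partial_deriv_scaleR[of "\<lambda>_. 2" v \<phi> i] d(1)[OF that] by (simp add: partial_deriv_def)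
    then show ?thesis
      using partial_deriv_cong[OF U that 1] partial_deriv_inner[OF d2 d(2), OF that that] by simp
  qed
  show "second_order_op a b (\<lambda>u. \<phi> u \<bullet> \<phi> u) u = 2 * (\<phi> u \<bullet> second_order_op a b \<phi> u) +
      2 * (\<Sum>i\<in>UNIV. \<Sum>j\<in>UNIV. a u $ i $ j * (partial_deriv i \<phi> u \<bullet> partial_deriv j \<phi> u))" if "u \<in> U"
    unfolding second_order_op_def 2[OF that] 1[OF that]
    by (simp add: inner_add_right inner_sum_right sum_distrib_left sum.distrib algebra_simps)
qed

text \<open>The products of first derivatives from the Leibniz rule, contracted with the inverse
  metric, give the trace of the identity matrix; this is the source of the dimension.\<close>

lemma second_order_op_norm_square_chart:
  assumes lp: "local_parametrization \<Sigma> U (\<phi> :: real^'n::finite \<Rightarrow> real^'m::finite)" and u: "u \<in> U"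
  shows "second_order_op (\<lambda>u. matrix_inv (induced_metric \<phi> u)) b (\<lambda>u. \<phi> u \<bullet> \<phi> u) u =
    2 * (\<phi> u \<bullet> second_order_op (\<lambda>u. matrix_inv (induced_metric \<phi> u)) b \<phi> u) + 2 * real CARD('n)"
proof -
  note D = local_parametrizationD[OF lp]
  let ?g = "induced_metric \<phi> u"
  have "matrix_inv ?g ** ?g = mat 1" using induced_metric_inverse[OF lp u] by metis
  have "(\<Sum>i\<in>UNIV. \<Sum>j\<in>UNIV. matrix_inv ?g $ i $ j * (partial_deriv i \<phi> u \<bullet> partial_deriv j \<phi> u))
     = (\<Sum>i\<in>UNIV. (matrix_inv ?g ** ?g) $ i $ i)"
    by (simp add: matrix_matrix_mult_def induced_metric_def inner_commute)
  also have "\<dots> = real CARD('n)"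
    unfolding \<open>matrix_inv ?g ** ?g = mat 1\<close> by (simp add: mat_def)
  finally show ?thesis using second_order_op_inner_self(2)[OF D(1,2) u] by simp
qed

text \<open>A curve \<open>\<gamma>\<close> in \<open>\<Sigma>\<close> is only differentiable in the ambient space, so its coordinate curve \<open>c\<close> is just
  continuous. The lower bound of the injective derivative makes \<open>c t - u\<close> of order \<open>t\<close>, which puts the
  velocity of \<open>\<gamma>\<close> into the closure of the range.\<close>
lemma tangent_space_chart:
  fixes \<phi> :: "real^'n::finite \<Rightarrow> real^'m::finite"
  assumes lp: "local_parametrization \<Sigma> U \<phi>" and u: "u \<in> U"
  shows "tangent_space \<Sigma> (\<phi> u) = range (frechet_derivative \<phi> (at u))"
proof (intro equalityI subsetI)
  note D = local_parametrizationD[OF lp]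
  let ?D = "frechet_derivative \<phi> (at u)"
  have d: "(\<phi> has_derivative ?D) (at u)"
    using D(2) u by (auto simp: twice_differentiable_on_def has_derivative_frechet)
  then have lin: "linear ?D" by (rule has_derivative_linear)
  interpret D: linear ?D by fact
  {
    fix v assume "v \<in> range ?D"
    then obtain x where x: "v = ?D x" by blast
    have "open ((\<lambda>t::real. u + t *\<^sub>R x) -` U)"
      by (intro open_vimage D(1) continuous_intros)
    moreover have "0 \<in> (\<lambda>t::real. u + t *\<^sub>R x) -` U" using u by simp
    ultimately obtain e where e: "e > 0" "ball 0 e \<subseteq> (\<lambda>t::real. u + t *\<^sub>R x) -` U"
      by (meson openE)
    \<comment> \<open>\<open>tangent_space\<close> asks for a curve on the whole real line, hence
      the constant continuation; the derivative at 0 does not see it.\<close>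
    define \<gamma> where "\<gamma> t = (if \<bar>t\<bar> < e then \<phi> (u + t *\<^sub>R x) else \<phi> u)" for t
    have "u + t *\<^sub>R x \<in> U" if "\<bar>t\<bar> < e" for t using e(2) that by (auto simp: subset_iff)
    then have "range \<gamma> \<subseteq> \<Sigma>" using D(5) u by (auto simp: \<gamma>_def)
    moreover have "\<gamma> 0 = \<phi> u" by (simp add: \<gamma>_def)
    moreover have "(\<gamma> has_vector_derivative v) (at 0)"
    proof -
      have "((\<lambda>t. u + t *\<^sub>R x) has_derivative (\<lambda>s. s *\<^sub>R x)) (at 0)"
        by (auto intro!: derivative_eq_intros)
      then have "((\<lambda>t. \<phi> (u + t *\<^sub>R x)) has_derivative (\<lambda>s. ?D (s *\<^sub>R x))) (at 0)"
        by (rule has_derivative_compose) (simp add: d)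
      then have "((\<lambda>t. \<phi> (u + t *\<^sub>R x)) has_vector_derivative v) (at 0)"
        by (simp add: has_vector_derivative_def x D.scaleR)
      then show ?thesis
        by (rule has_vector_derivative_transform_within_open[where S = "ball 0 e"]) (use e in \<open>auto simp: \<gamma>_def\<close>)
    qed
    ultimately show "v \<in> tangent_space \<Sigma> (\<phi> u)" by (auto simp: tangent_space_def)
  }
  fix v assume "v \<in> tangent_space \<Sigma> (\<phi> u)"
  then obtain \<gamma> where \<gamma>: "range \<gamma> \<subseteq> \<Sigma>" "\<gamma> 0 = \<phi> u" "(\<gamma> has_vector_derivative v) (at 0)"
    by (auto simp: tangent_space_def)
  obtain \<psi> where \<psi>: "homeomorphism U (\<phi> ` U) \<phi> \<psi>" and op: "openin (top_of_set \<Sigma>) (\<phi> ` U)"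
    using lp by (auto simp: local_parametrization_def)
  obtain B where B: "B > 0" "\<And>x. B * norm x \<le> norm (?D x)"
    using linear_inj_bounded_below_pos[OF lin D(4)[OF u]] by blast
  define c where "c t = \<psi> (\<gamma> t)" for t
  have "continuous (at 0) \<gamma>" using \<gamma>(3) has_vector_derivative_continuous by blast
  then have \<gamma>_lim: "(\<gamma> \<longlongrightarrow> \<phi> u) (at 0)" using \<gamma>(2) by (simp add: continuous_at)
  obtain T where T: "open T" "\<phi> ` U = \<Sigma> \<inter> T" using op by (auto simp: openin_open)
  have "\<phi> u \<in> T" using T u by blast
  then have "\<forall>\<^sub>F t in at 0. \<gamma> t \<in> T" using topological_tendstoD[OF \<gamma>_lim T(1)] by blast
  then have ev: "\<forall>\<^sub>F t in at 0. \<gamma> t \<in> \<phi> ` U"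
    by (rule eventually_mono) (use T \<gamma>(1) in auto)
  have \<psi>\<phi>: "\<psi> (\<phi> x) = x" if "x \<in> U" for x using \<psi> that by (simp add: homeomorphism_def)
  have c_lim: "(c \<longlongrightarrow> u) (at 0)"
  proof -
    have "((\<lambda>t. \<psi> (\<gamma> t)) \<longlongrightarrow> \<psi> (\<phi> u)) (at 0)"
      using u by (intro continuous_on_tendsto_compose[OF homeomorphism_cont2[OF \<psi>] \<gamma>_lim _ ev]) simp
    then show ?thesis using \<psi>\<phi>[OF u] by (simp add: c_def[abs_def])
  qed
  have c: "\<forall>\<^sub>F t in at 0. \<phi> (c t) = \<gamma> t"
    using ev by (rule eventually_mono) (auto simp: c_def \<psi>\<phi>)
  have "v \<in> closure (range ?D)"
    unfolding closure_approachable
  proof (intro allI impI)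
    fix \<eta> :: real assume \<eta>: "\<eta> > 0"
    \<comment> \<open>The bound \<open>B / 2\<close> lets half of \<open>B * N\<close> absorb the
      remainder of \<open>\<phi>\<close>, so that \<open>B * N\<close> is at most
      \<open>2 * (norm v + 1) * \<bar>t\<bar>\<close>. The second bound then turns the remainder
      \<open>\<epsilon> * N\<close> into at most \<open>\<eta> / 4 * \<bar>t\<bar>\<close>, which
      together with \<open>\<eta> / 2 * \<bar>t\<bar>\<close> from the curve stays below
      \<open>\<eta> * \<bar>t\<bar>\<close>.\<close>
    define \<epsilon> where "\<epsilon> = min (B / 2) (\<eta> * B / (8 * (norm v + 1)))"
    have \<epsilon>: "\<epsilon> > 0" using B(1) \<eta> by (simp add: \<epsilon>_def add_nonneg_pos)
    have \<epsilon>B: "\<epsilon> \<le> B / 2" unfolding \<epsilon>_def by (rule min.cobounded1)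
    have "\<epsilon> * (norm v + 1) \<le> \<eta> * B / (8 * (norm v + 1)) * (norm v + 1)"
      by (intro mult_right_mono) (auto simp: \<epsilon>_def)
    also have "\<dots> = \<eta> * B / 8"
      using norm_ge_zero[of v] by (auto simp: field_simps add_nonneg_eq_0_iff)
    finally have \<epsilon>v: "\<epsilon> * (norm v + 1) \<le> \<eta> * B / 8" .
    obtain \<delta> where \<delta>: "\<delta> > 0" "\<And>y. norm (y - u) < \<delta> \<Longrightarrow> norm (\<phi> y - \<phi> u - ?D (y - u)) \<le> \<epsilon> * norm (y - u)"
      using d \<epsilon> unfolding has_derivative_at_alt by blast
    have "min (\<eta> / 2) 1 > 0" using \<eta> by simp
    then obtain \<delta>' where \<delta>': "\<delta>' > 0" "\<And>t. norm (t - 0) < \<delta>' \<Longrightarrow>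
        norm (\<gamma> t - \<gamma> 0 - (t - 0) *\<^sub>R v) \<le> min (\<eta> / 2) 1 * norm (t - 0)"
      using \<gamma>(3) unfolding has_vector_derivative_def has_derivative_at_alt by blast
    have "\<forall>\<^sub>F t in at 0. dist (c t) u < \<delta>" using tendstoD[OF c_lim \<delta>(1)] .
    moreover have "\<forall>\<^sub>F t in at 0. dist t (0::real) < \<delta>'" using tendstoD[OF tendsto_ident_at \<delta>'(1)] .
    ultimately have "\<forall>\<^sub>F t in at 0. \<phi> (c t) = \<gamma> t \<and> dist (c t) u < \<delta> \<and> dist t 0 < \<delta>' \<and> t \<noteq> 0"
      using c eventually_neq_at_within[of 0 0 UNIV] by eventually_elim simp
    then obtain t where t: "\<phi> (c t) = \<gamma> t" "dist (c t) u < \<delta>" "dist t 0 < \<delta>'" "t \<noteq> 0"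
      using eventually_happens'[OF at_neq_bot] by blast
    define N where "N = norm (c t - u)"
    have r: "norm (\<gamma> t - \<phi> u - ?D (c t - u)) \<le> \<epsilon> * N"
      using \<delta>(2)[of "c t"] t by (simp add: N_def dist_norm)
    have k: "norm (\<gamma> t - \<phi> u - t *\<^sub>R v) \<le> min (\<eta> / 2) 1 * \<bar>t\<bar>"
      using \<delta>'(2)[of t] t \<gamma>(2) by (simp add: dist_norm)
    have "B * N \<le> norm (?D (c t - u))" using B(2) by (simp add: N_def)
    also have "\<dots> \<le> norm (\<gamma> t - \<phi> u) + norm (\<gamma> t - \<phi> u - ?D (c t - u))"
      using norm_triangle_ineq4[of "\<gamma> t - \<phi> u" "\<gamma> t - \<phi> u - ?D (c t - u)"] by simp
    also have "norm (\<gamma> t - \<phi> u) \<le> norm (t *\<^sub>R v) + norm (\<gamma> t - \<phi> u - t *\<^sub>R v)"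
      using norm_triangle_ineq[of "t *\<^sub>R v" "\<gamma> t - \<phi> u - t *\<^sub>R v"] by simp
    also have "norm (\<gamma> t - \<phi> u - t *\<^sub>R v) \<le> \<bar>t\<bar>"
      using k mult_right_mono[of "min (\<eta> / 2) 1" 1 "\<bar>t\<bar>"] by simp
    also have "norm (\<gamma> t - \<phi> u - ?D (c t - u)) \<le> B / 2 * N"
      using r mult_right_mono[of \<epsilon> "B / 2" N, OF \<epsilon>B] by (simp add: N_def)
    finally have "B * N \<le> 2 * (norm v + 1) * \<bar>t\<bar>" by (simp add: algebra_simps)
    then have "\<epsilon> * (B * N) \<le> \<epsilon> * (2 * (norm v + 1) * \<bar>t\<bar>)" using \<epsilon> by (intro mult_left_mono) auto
    also have "\<dots> = 2 * \<bar>t\<bar> * (\<epsilon> * (norm v + 1))" by (simp add: algebra_simps)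
    also have "\<dots> \<le> 2 * \<bar>t\<bar> * (\<eta> * B / 8)" using \<epsilon>v by (intro mult_left_mono) auto
    finally have "\<epsilon> * N * B \<le> (\<eta> / 4 * \<bar>t\<bar>) * B" by (simp add: algebra_simps)
    then have "\<epsilon> * N \<le> \<eta> / 4 * \<bar>t\<bar>" using B(1) by simp
    then have r': "norm (\<gamma> t - \<phi> u - ?D (c t - u)) \<le> \<eta> / 4 * \<bar>t\<bar>" using r by simp
    have k': "norm (\<gamma> t - \<phi> u - t *\<^sub>R v) \<le> \<eta> / 2 * \<bar>t\<bar>"
      using k mult_right_mono[of "min (\<eta> / 2) 1" "\<eta> / 2" "\<bar>t\<bar>", OF min.cobounded1] by simp
    have "norm (?D (c t - u) - t *\<^sub>R v) \<le> norm (\<gamma> t - \<phi> u - t *\<^sub>R v) + norm (\<gamma> t - \<phi> u - ?D (c t - u))"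
      using norm_triangle_ineq4[of "\<gamma> t - \<phi> u - t *\<^sub>R v" "\<gamma> t - \<phi> u - ?D (c t - u)"] by (simp add: algebra_simps)
    also have "\<dots> < \<eta> * \<bar>t\<bar>"
    proof -
      have "\<eta> * \<bar>t\<bar> > 0" using \<eta> t(4) by simp
      then show ?thesis using r' k' by simp
    qed
    finally have "norm (?D (c t - u) - t *\<^sub>R v) < \<eta> * \<bar>t\<bar>" .
    moreover have "?D (c t - u) - t *\<^sub>R v = t *\<^sub>R (?D ((1 / t) *\<^sub>R (c t - u)) - v)"
      unfolding D.scaleR using t(4) by (simp add: scaleR_diff_right)
    ultimately have "\<bar>t\<bar> * norm (?D ((1 / t) *\<^sub>R (c t - u)) - v) < \<bar>t\<bar> * \<eta>" by (simp add: mult.commute)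
    then have "dist (?D ((1 / t) *\<^sub>R (c t - u))) v < \<eta>" using t(4) by (simp add: dist_norm)
    then show "\<exists>y\<in>range ?D. dist y v < \<eta>" by blast
  qed
  moreover have "closed (range ?D)"
    by (intro closed_subspace linear_subspace_image lin subspace_UNIV)
  ultimately show "v \<in> range ?D" by simp
qed

section \<open>Closed homothetic solitons\<close>

text \<open>The definite description has to be justified before it can be used. Existence comes from
  the orthogonal decomposition along the span, which is the tangent space itself by the
  hypothesis.\<close>

lemma normal_position_decomp:
  assumes "subspace (tangent_space \<Sigma> p)"
  shows "normal_position \<Sigma> p \<bullet> p = normal_position \<Sigma> p \<bullet> normal_position \<Sigma> p"
proof -
  let ?T = "tangent_space \<Sigma> p"
  obtain y z where yz: "y \<in> span ?T" "\<And>w. w \<in> span ?T \<Longrightarrow> orthogonal z w" "p = y + z"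
    using orthogonal_subspace_decomp_exists[of ?T p] by blast
  have unique: "w' = w" if w: "w \<in> ?T\<^sup>\<bottom>" "p - w \<in> ?T" and w': "w' \<in> ?T\<^sup>\<bottom>" "p - w' \<in> ?T" for w w'
  proof -
    have "(p - w) \<bullet> w = 0" "(p - w) \<bullet> w' = 0" "(p - w') \<bullet> w = 0" "(p - w') \<bullet> w' = 0"
      using w w' by (auto simp: orthogonal_comp_def orthogonal_def)
    then have "(w - w') \<bullet> (w - w') = 0"
      by (simp add: inner_diff_left inner_diff_right inner_commute)
    then show ?thesis by simp
  qed
  have "\<exists>!w. w \<in> ?T\<^sup>\<bottom> \<and> p - w \<in> ?T"
  proof (rule ex_ex1I)
    show "\<exists>w. w \<in> ?T\<^sup>\<bottom> \<and> p - w \<in> ?T"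
      using yz assms by (intro exI[of _ z]) (auto simp: orthogonal_comp_def orthogonal_commute span_eq_iff[THEN iffD2])
  qed (use unique in blast)
  from theI'[OF this] have "normal_position \<Sigma> p \<in> ?T\<^sup>\<bottom>" "p - normal_position \<Sigma> p \<in> ?T"
    unfolding normal_position_def by blast+
  then have "(p - normal_position \<Sigma> p) \<bullet> normal_position \<Sigma> p = 0"
    by (simp add: orthogonal_comp_def orthogonal_def)
  then show ?thesis by (simp add: inner_diff_left inner_diff_right inner_commute)
qed

text \<open>With s the squared norm of h, the equation reads h = - s C w. Taking squared norms gives
  s C (w . w) = 1 / C, and by the last hypothesis the left side is - (h . p).\<close>

lemma homothetic_soliton_inner_position:
  fixes h p w :: "'a::real_inner"
  assumes "- ((1 / (norm h)\<^sup>2) *\<^sub>R h) = C *\<^sub>R w" "h \<noteq> 0" "w \<bullet> p = w \<bullet> w"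
  shows "h \<bullet> p = - 1 / C"
proof -
  define s where "s = (norm h)\<^sup>2"
  have s: "s > 0" using assms(2) by (simp add: s_def)
  have "h = (- s) *\<^sub>R (- ((1 / s) *\<^sub>R h))" using s by simp
  also have "\<dots> = (- s * C) *\<^sub>R w" unfolding s_def assms(1) by simp
  finally have h: "h = (- s * C) *\<^sub>R w" .
  have "s = h \<bullet> h" by (simp add: s_def power2_norm_eq_inner)
  also have "\<dots> = (- s * C) * ((- s * C) * (w \<bullet> w))" by (subst (1 2) h) simp
  finally have "C * (s * C * (w \<bullet> w)) = 1" using s by (simp add: algebra_simps)
  moreover have "h \<bullet> p = - (s * C * (w \<bullet> w))" by (subst h) (simp add: assms(3))
  ultimately show ?thesis by (cases "C = 0") (auto simp: field_simps)
qed

text \<open>Invariance of domain is applied to the cone map \<open>(u, t) \<mapsto> t \<phi>(u)\<close>.\<close>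
lemma chart_in_sphere_openin:
  fixes \<phi> :: "real^'n::finite \<Rightarrow> real^'m::finite"
  assumes "CARD('m) = CARD('n) + 1" and lp: "local_parametrization \<Sigma> U \<phi>"
    and sph: "\<Sigma> \<subseteq> sphere 0 r" and r: "r > 0"
  shows "openin (top_of_set (sphere 0 r)) (\<phi> ` U)"
proof -
  note D = local_parametrizationD[OF lp]
  have norm: "norm (\<phi> u) = r" if "u \<in> U" for u using D(5) sph that by (auto simp: subset_iff)
  obtain \<psi> where \<psi>: "homeomorphism U (\<phi> ` U) \<phi> \<psi>" using lp by (auto simp: local_parametrization_def)
  define F where "F z = snd z *\<^sub>R \<phi> (fst z)" for z :: "(real^'n) \<times> real"
  let ?W = "U \<times> {0::real<..}"
  have "open (F ` ?W)"
  proof (rule invariance_of_domain_gen)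
    show "open ?W" by (intro open_Times D(1) open_greaterThan)
    show "continuous_on ?W F"
      unfolding F_def by (intro continuous_intros continuous_on_compose2[OF homeomorphism_cont1[OF \<psi>]]) auto
    show "inj_on F ?W"
    proof (rule inj_onI)
      fix y z assume *: "y \<in> ?W" "z \<in> ?W" "F y = F z"
      \<comment> \<open>On the cone the norm is \<open>r\<close> times the scalar, so it recovers
        the scalar; injectivity of the chart does the rest.\<close>
      then have "norm (F y) = norm (F z)" by simp
      then have "snd y = snd z" using * norm r by (auto simp: F_def)
      then have "\<phi> (fst y) = \<phi> (fst z)" using * by (auto simp: F_def)
      then have "fst y = fst z" using * \<psi> by (metis homeomorphism_def SigmaE fst_conv)
      then show "y = z" using \<open>snd y = snd z\<close> by (rule prod_eqI)
    qed
    show "DIM(real^'m) \<le> DIM((real^'n) \<times> real)" using assms(1) by simp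
  qed
  moreover have "\<phi> ` U = sphere 0 r \<inter> F ` ?W"
  proof (intro equalityI subsetI)
    fix x assume "x \<in> \<phi> ` U"
    then obtain u where u: "u \<in> U" "x = \<phi> u" by blast
    then have "x = F (u, 1)" "(u, 1) \<in> ?W" by (auto simp: F_def)
    then have "x \<in> F ` ?W" by (rule image_eqI)
    then show "x \<in> sphere 0 r \<inter> F ` ?W" using norm[OF u(1)] u(2) by simp
  next
    fix x assume "x \<in> sphere 0 r \<inter> F ` ?W"
    then obtain u t where u: "u \<in> U" "t > 0" "x = t *\<^sub>R \<phi> u" "norm x = r" by (auto simp: F_def)
    then have "t = 1" using norm r by simp
    then show "x \<in> \<phi> ` U" using u by simp
  qed
  ultimately show ?thesis by (auto simp: openin_open)
qed

theorem theorem12: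
  fixes \<Sigma> :: "(real^'m::finite) set"
  assumes "CARD('n::finite) \<ge> 2"
    and "CARD('m) = CARD('n) + 1"
    and "homothetic_soliton TYPE('n) \<Sigma>"
    and "compact \<Sigma>" and "connected \<Sigma>" and "\<Sigma> \<noteq> {}"
  shows "\<exists>r>0. \<Sigma> = sphere 0 r"
proof -
  obtain H C where H: "mean_curvature_field TYPE('n) \<Sigma> H" "\<And>p. p \<in> \<Sigma> \<Longrightarrow> H p \<noteq> 0"
    and C: "C \<noteq> 0"
    and soliton: "\<And>p. p \<in> \<Sigma> \<Longrightarrow> - ((1 / (norm (H p))\<^sup>2) *\<^sub>R H p) = C *\<^sub>R normal_position \<Sigma> p"
    using assms(3) unfolding homothetic_soliton_def by blast
  have atlas: "\<exists>U (\<phi> :: real^'n \<Rightarrow> real^'m). local_parametrization \<Sigma> U \<phi> \<and> p \<in> \<phi> ` U" if "p \<in> \<Sigma>" for p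
    using assms(3) that unfolding homothetic_soliton_def submanifold_def by blast
  have Hp: "H p \<bullet> p = - 1 / C" if p: "p \<in> \<Sigma>" for p
  proof -
    obtain U and \<phi> :: "real^'n \<Rightarrow> real^'m" and u where lp: "local_parametrization \<Sigma> U \<phi>" "u \<in> U" "p = \<phi> u"
      using atlas[OF p] by blast
    have "linear (frechet_derivative \<phi> (at u))"
      using local_parametrizationD(2)[OF lp(1)] lp(2)
      by (auto simp: twice_differentiable_on_def linear_frechet_derivative)
    then have "subspace (tangent_space \<Sigma> p)"
      unfolding lp(3) tangent_space_chart[OF lp(1,2)] by (intro linear_subspace_image subspace_UNIV)
    then show ?thesis
      by (intro homothetic_soliton_inner_position[OF soliton[OF p] H(2)[OF p]] normal_position_decomp)
  qed
  define c where "c = 2 * real CARD('n) - 2 / C"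
  \<comment> \<open>Collects the local data on which both the second derivative test and the strong
    maximum principle operate.\<close>
  have chart: "\<exists>U (\<phi> :: real^'n \<Rightarrow> real^'m) a b u. local_parametrization \<Sigma> U \<phi> \<and> u \<in> U \<and> p = \<phi> u \<and>
      continuous_on U a \<and> continuous_on U b \<and>
      (\<forall>u\<in>U. \<exists>V :: real^'n^'n. invertible V \<and> a u = V ** transpose V) \<and>
      (\<forall>u\<in>U. second_order_op a b (\<lambda>u. \<phi> u \<bullet> \<phi> u) u = c)" if p: "p \<in> \<Sigma>" for p
  proof -
    obtain U and \<phi> :: "real^'n \<Rightarrow> real^'m" and u where lp: "local_parametrization \<Sigma> U \<phi>" "u \<in> U" "p = \<phi> u"
      using atlas[OF p] by blast
    let ?a = "\<lambda>u. matrix_inv (induced_metric \<phi> u)"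
    obtain b where b: "continuous_on U ?a" "continuous_on U b"
        "\<And>u. u \<in> U \<Longrightarrow> laplace_beltrami (induced_metric \<phi>) \<phi> u = second_order_op ?a b \<phi> u"
      using laplace_beltrami_chart[OF lp(1)] by blast
    have "second_order_op ?a b (\<lambda>u. \<phi> u \<bullet> \<phi> u) v = c" if v: "v \<in> U" for v
    proof -
      have "\<phi> v \<in> \<Sigma>" using local_parametrizationD(5)[OF lp(1)] v by blast
      moreover have "H (\<phi> v) = second_order_op ?a b \<phi> v"
        using H(1) lp(1) v b(3) by (simp add: mean_curvature_field_def)
      ultimately show ?thesis
        unfolding second_order_op_norm_square_chart[OF lp(1) v] c_def using Hp[of "\<phi> v"]
        by (simp add: inner_commute)
    qed
    moreover have "\<exists>V :: real^'n^'n. invertible V \<and> ?a v = V ** transpose V" if "v \<in> U" for v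
      using induced_metric_inverse[OF lp(1) that] by metis
    ultimately show ?thesis using lp b(1,2) by blast
  qed
  have cont: "continuous_on \<Sigma> (\<lambda>p. p \<bullet> p)" by (intro continuous_intros)
  obtain pM where pM: "pM \<in> \<Sigma>" "\<And>p. p \<in> \<Sigma> \<Longrightarrow> p \<bullet> p \<le> pM \<bullet> pM"
    using continuous_attains_sup[OF assms(4,6) cont] by blast
  obtain pm where pm: "pm \<in> \<Sigma>" "\<And>p. p \<in> \<Sigma> \<Longrightarrow> pm \<bullet> pm \<le> p \<bullet> p"
    using continuous_attains_inf[OF assms(4,6) cont] by blast
  have "c \<le> 0"
  proof -
    obtain U and \<phi> :: "real^'n \<Rightarrow> real^'m" and a b u V where ch: "local_parametrization \<Sigma> U \<phi>" "u \<in> U" "pM = \<phi> u"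
      "a u = V ** transpose (V :: real^'n^'n)" "second_order_op a b (\<lambda>u. \<phi> u \<bullet> \<phi> u) u = c"
      using chart[OF pM(1)] by blast
    note D = local_parametrizationD[OF ch(1)]
    have "second_order_op a b (\<lambda>u. \<phi> u \<bullet> \<phi> u) u \<le> 0"
      by (rule second_order_op_nonpos_at_max[where a = a and u = u and V = V, OF D(1) ch(2) second_order_op_inner_self(1)[OF D(1,2)] _ ch(4)])
        (use pM(2) ch(3) D(5) in auto)
    then show ?thesis using ch(5) by simp
  qed
  moreover have "c \<ge> 0"
  proof -
    obtain U and \<phi> :: "real^'n \<Rightarrow> real^'m" and a b u V where ch: "local_parametrization \<Sigma> U \<phi>" "u \<in> U" "pm = \<phi> u"
      "a u = V ** transpose (V :: real^'n^'n)" "second_order_op a b (\<lambda>u. \<phi> u \<bullet> \<phi> u) u = c"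
      using chart[OF pm(1)] by blast
    note D = local_parametrizationD[OF ch(1)]
    note tw = second_order_op_inner_self(1)[OF D(1,2)]
    \<comment> \<open>The minimum is treated as a maximum of the negative function.\<close>
    have "second_order_op a b (\<lambda>u. (- 1) * (\<phi> u \<bullet> \<phi> u)) u \<le> 0"
      by (rule second_order_op_nonpos_at_max[where a = a and u = u and V = V, OF D(1) ch(2) twice_differentiable_on_cmult(1)[OF D(1) tw] _ ch(4)])
        (use pm(2) ch(3) D(5) in auto)
    then show ?thesis using ch(5) twice_differentiable_on_cmult(2)[OF D(1) tw ch(2), of a b "- 1"] by simp
  qed
  ultimately have "c = 0" by simp
  define M where "M = pM \<bullet> pM"
  define K where "K = {p \<in> \<Sigma>. p \<bullet> p = M}"
  \<comment> \<open>The strong maximum principle gives openness in the parameter domain, and charts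
    carry open sets to relatively open subsets of \<Sigma>.\<close>
  have "openin (top_of_set \<Sigma>) K"
    unfolding openin_subopen[of _ K]
  proof
    fix p assume p: "p \<in> K"
    then have "p \<in> \<Sigma>" by (simp add: K_def)
    from chart[OF this] obtain U and \<phi> :: "real^'n \<Rightarrow> real^'m" and a b u where
      ch: "local_parametrization \<Sigma> U \<phi>" "u \<in> U" "p = \<phi> u" "continuous_on U a" "continuous_on U b"
        "\<And>u. u \<in> U \<Longrightarrow> \<exists>V :: real^'n^'n. invertible V \<and> a u = V ** transpose V"
        "\<And>u. u \<in> U \<Longrightarrow> second_order_op a b (\<lambda>u. \<phi> u \<bullet> \<phi> u) u = c"
      by blast
    note D = local_parametrizationD[OF ch(1)]
    let ?W = "{u \<in> U. \<phi> u \<bullet> \<phi> u = M}"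
    have "open ?W"
      by (rule strong_maximum_principle[OF D(1) ch(4,6,5) second_order_op_inner_self(1)[OF D(1,2)]])
        (use ch(7) \<open>c = 0\<close> pM(2) D(5) in \<open>auto simp: M_def\<close>)
    then have "openin (top_of_set \<Sigma>) (\<phi> ` ?W)" by (rule D(6)) simp
    moreover have "p \<in> \<phi> ` ?W" using p ch(2,3) by (auto simp: K_def)
    moreover have "\<phi> ` ?W \<subseteq> K" using D(5) by (auto simp: K_def)
    ultimately show "\<exists>T. openin (top_of_set \<Sigma>) T \<and> p \<in> T \<and> T \<subseteq> K" by blast
  qed
  moreover have "closedin (top_of_set \<Sigma>) K"
    unfolding K_def by (rule continuous_closedin_preimage_constant[OF cont])
  moreover have "pM \<in> K" using pM(1) by (simp add: K_def M_def)
  ultimately have "K = \<Sigma>" using assms(5) unfolding connected_clopen by blast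
  define r where "r = norm pM"
  have sub: "\<Sigma> \<subseteq> sphere 0 r"
  proof
    fix p assume "p \<in> \<Sigma>"
    then have "p \<bullet> p = pM \<bullet> pM" using \<open>K = \<Sigma>\<close> by (auto simp: K_def M_def)
    then show "p \<in> sphere 0 r" by (simp add: r_def norm_eq_sqrt_inner)
  qed
  \<comment> \<open>At the origin \<open>H pM \<bullet> pM\<close> would vanish, but it equals
    \<open>- 1 / C\<close>.\<close>
  have "pM \<noteq> 0" using Hp[OF pM(1)] C by auto
  then have r: "r > 0" by (simp add: r_def)
  have "openin (top_of_set (sphere 0 r)) \<Sigma>"
    unfolding openin_subopen[of _ \<Sigma>]
  proof
    fix p assume "p \<in> \<Sigma>"
    from atlas[OF this] obtain U and \<phi> :: "real^'n \<Rightarrow> real^'m" where lp: "local_parametrization \<Sigma> U \<phi>" "p \<in> \<phi> ` U"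
      by blast
    then show "\<exists>T. openin (top_of_set (sphere 0 r)) T \<and> p \<in> T \<and> T \<subseteq> \<Sigma>"
      using chart_in_sphere_openin[OF assms(2) lp(1) sub r] local_parametrizationD(5)[OF lp(1)] by blast
  qed
  moreover have "closedin (top_of_set (sphere 0 r)) \<Sigma>"
    using sub assms(4) by (simp add: closed_subset compact_imp_closed)
  \<comment> \<open>The bound on the dimension enters through the connectedness of the sphere, in
    which \<Sigma> is now nonempty, open and closed.\<close>
  moreover have "connected (sphere (0 :: real^'m) r)"
    using assms(1,2) by (intro connected_sphere) simp
  ultimately have "\<Sigma> = sphere 0 r" using assms(6) unfolding connected_clopen by blast
  then show ?thesis using r by blast
qed

end
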